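(* Let $R$ be a complete intersection SAGA of codimension $n+1\ge6$ presented by quadrics, and let $z\in R^1\setminus\{0\}$ be a non-Lefschetz element in degree $1$ (i.e. $zw=0$ for some $w\in R^1\setminus\{0\}$). If $\bar R=R/(z)$ satisfies $WLP_2$, then $R$ satisfies $WLP_2$.
   Context: $\mathbb K$ is an algebraically closed field of characteristic $0$. A complete intersection SAGA of codimension $n+1$ presented by quadrics is $R=S/I$, $S=\mathbb K[x_0,\dots,x_n]$, $I$ generated by a regular sequence of $n+1$ homogeneous quadrics (standard graded Artinian Gorenstein, socle degree $n+1$). A graded algebra $A$ satisfies $WLP_k$ if there is $x\in A^1$ such that $x\cdot:A^k\to A^{k+1}$ has maximal rank. An element $[x]\in\mathbb P(R^1)$ is a Lefschetz element in degree $1$ if $x\cdot:R^1\to R^2$ has maximal rank (here: is injective); otherwise it is a non-Lefschetz element. *)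

theory Defs
  imports Main "HOL-Library.Poly_Mapping" "HOL-Computational_Algebra.Polynomial"
begin

text \<open>Polynomials in the variables x_0, x_1, ... with coefficients in 'k:
  finitely supported maps from monomials (exponent vectors nat =>0 nat) to 'k,
  with the convolution product of HOL-Library.Poly_Mapping.\<close>
type_synonym 'k mpol = "(nat \<Rightarrow>\<^sub>0 nat) \<Rightarrow>\<^sub>0 'k"

definition alg_closed_field :: "'k::field itself \<Rightarrow> bool" where
  "alg_closed_field _ \<longleftrightarrow> (\<forall>p :: 'k poly. degree p > 0 \<longrightarrow> (\<exists>x. poly p x = 0))"

definition mon_deg :: "(nat \<Rightarrow>\<^sub>0 nat) \<Rightarrow> nat" where
  "mon_deg m = (\<Sum>i\<in>Poly_Mapping.keys m. Poly_Mapping.lookup m i)"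

definition in_S :: "nat \<Rightarrow> 'k::zero mpol \<Rightarrow> bool" where
  "in_S n p \<longleftrightarrow> (\<forall>m\<in>Poly_Mapping.keys p. Poly_Mapping.keys m \<subseteq> {..n})"

definition homog :: "nat \<Rightarrow> nat \<Rightarrow> 'k::zero mpol \<Rightarrow> bool" where
  "homog n d p \<longleftrightarrow> in_S n p \<and> (\<forall>m\<in>Poly_Mapping.keys p. mon_deg m = d)"

definition ideal_gen :: "nat \<Rightarrow> 'k::comm_ring_1 mpol list \<Rightarrow> 'k mpol set" where
  "ideal_gen n gs = {p. \<exists>a. (\<forall>i<length gs. in_S n (a i)) \<and> p = (\<Sum>i<length gs. a i * gs ! i)}"

definition regular_seq :: "nat \<Rightarrow> 'k::comm_ring_1 mpol list \<Rightarrow> bool" where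
  "regular_seq n qs \<longleftrightarrow>
     (\<forall>i<length qs. \<forall>f. in_S n f \<and> f * qs ! i \<in> ideal_gen n (take i qs)
         \<longrightarrow> f \<in> ideal_gen n (take i qs))
     \<and> 1 \<notin> ideal_gen n qs"

text \<open>For a homogeneous ideal J of S, with A = S/J, the map (x mult.) : A^k -> A^(k+1)
  (x a linear form) has maximal rank, i.e. is injective or surjective.\<close>
definition max_rank_mult :: "nat \<Rightarrow> 'k::comm_ring_1 mpol set \<Rightarrow> 'k mpol \<Rightarrow> nat \<Rightarrow> bool" where
  "max_rank_mult n J x k \<longleftrightarrow>
     (\<forall>f. homog n k f \<and> x * f \<in> J \<longrightarrow> f \<in> J)
   \<or> (\<forall>g. homog n (k+1) g \<longrightarrow> (\<exists>f. homog n k f \<and> g - x * f \<in> J))"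

definition WLP :: "nat \<Rightarrow> 'k::comm_ring_1 mpol set \<Rightarrow> nat \<Rightarrow> bool" where
  "WLP n J k \<longleftrightarrow> (\<exists>x. homog n 1 x \<and> max_rank_mult n J x k)"

end

theory Submission
  imports Defs
begin

text \<open>Since \<open>z w\<close> is a nonzero combination of the quadrics, it can replace one of them; let \<open>Q\<close> be the
  remaining \<open>n\<close> quadrics. Then \<open>I : z = (w) + Q\<close> and \<open>I + (z) = (z) + Q\<close>, so both \<open>R/(0 : z)\<close> and
  \<open>R/(z)\<close> are, after eliminating a variable, complete intersections of \<open>n\<close> quadrics in \<open>n\<close> variables.

  In such an algebra \<open>A\<close> some linear form is injective in degree 1: otherwise let \<open>y\<close> span the kernel of
  \<open>x\<close>. A tangent argument gives \<open>y A\<^sup>1 \<subseteq> x A\<^sup>1\<close>, so \<open>y\<^sup>2\<close> is a socle element of degree 2, hence zero, hence \<open>y\<close>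
  is a multiple of \<open>x\<close> and \<open>x\<^sup>2 = 0\<close> for all \<open>x\<close>, which is impossible. For \<open>n \<ge> 5\<close>, a dimension count shows
  that a linear form of maximal rank on \<open>A\<^sup>2\<close> is injective there. A general \<open>x\<close> is therefore injective on
  \<open>z R\<^sup>1\<close> and on \<open>(R/(z))\<^sup>2\<close>, hence on \<open>R\<^sup>2\<close>.\<close>

section \<open>Polynomials and forms in a set of variables\<close>

text \<open>\<open>regular_seq\<close> depends on the order of its entries, whereas the quadric
  replaced by \<open>z * w\<close> may stand at any position, and the two quotients come with no
  regular sequence at hand. Regularity is therefore traded at once for the statement that all
  syzygies of the quadrics are Koszul, which does not see the order. Of this, only what happens in
  degrees 1 and 2 is carried along (locale \<open>quadrics\<close>); it is available for every
  subfamily and survives the quotient by a linear form that is a non-zero-divisor modulo the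
  quadrics.

  General position is handled without Zariski topology: in a pencil of linear maps with one
  injective member only finitely many members fail to be injective, and the field is infinite. The
  final form is \<open>x1 + t x2\<close>, with \<open>x1\<close> injective on z R^1 and
  \<open>x2\<close> on degree 2 of R/(z). The quotient by \<open>w\<close> yields \<open>x1\<close>
  because multiplication by \<open>z\<close> identifies R/(0 : z) with z R.

  The bound on \<open>n\<close> arises because A^2 and A^3 have dimensions \<open>n choose 2\<close>
  and \<open>n choose 3\<close>, and from n = 5 on the former does not exceed the latter.\<close>

definition cst :: "'k::zero \<Rightarrow> 'k mpol" where
  "cst c = Poly_Mapping.single 0 c"

definition var :: "nat \<Rightarrow> 'k::zero_neq_one mpol" where
  "var i = Poly_Mapping.single (Poly_Mapping.single i 1) 1"

definition polys :: "nat set \<Rightarrow> 'k::zero mpol set" where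
  "polys V = {p. \<forall>m\<in>Poly_Mapping.keys p. Poly_Mapping.keys m \<subseteq> V}"

definition forms :: "nat set \<Rightarrow> nat \<Rightarrow> 'k::zero mpol set" where
  "forms V d = {p \<in> polys V. \<forall>m\<in>Poly_Mapping.keys p. mon_deg m = d}"

lemma in_S_iff_polys: "in_S n p \<longleftrightarrow> p \<in> polys {..n}"
  by (simp add: in_S_def polys_def)

lemma homog_iff_forms: "homog n d p \<longleftrightarrow> p \<in> forms {..n} d"
  by (simp add: homog_def forms_def in_S_iff_polys)

lemma forms_subset_polys: "forms V d \<subseteq> polys V"
  by (auto simp: forms_def)

lemma keys_add_nat:
  fixes a b :: "'a \<Rightarrow>\<^sub>0 nat"
  shows "Poly_Mapping.keys (a + b) = Poly_Mapping.keys a \<union> Poly_Mapping.keys b"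
  by (auto simp: in_keys_iff lookup_add)

lemma mon_deg_superset:
  assumes "finite V" "Poly_Mapping.keys m \<subseteq> V"
  shows "mon_deg m = (\<Sum>i\<in>V. Poly_Mapping.lookup m i)"
  unfolding mon_deg_def using assms by (intro sum.mono_neutral_left) (auto simp: in_keys_iff)

lemma mon_deg_add: "mon_deg (a + b) = mon_deg a + mon_deg b"
proof -
  let ?V = "Poly_Mapping.keys a \<union> Poly_Mapping.keys b"
  have "mon_deg (a + b) = (\<Sum>i\<in>?V. Poly_Mapping.lookup (a + b) i)"
    by (intro mon_deg_superset) (auto simp: keys_add_nat)
  moreover have "mon_deg a = (\<Sum>i\<in>?V. Poly_Mapping.lookup a i)"
    "mon_deg b = (\<Sum>i\<in>?V. Poly_Mapping.lookup b i)"
    by (intro mon_deg_superset; auto)+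
  ultimately show ?thesis
    by (simp add: lookup_add sum.distrib)
qed

lemma mon_deg_0 [simp]: "mon_deg 0 = 0"
  by (simp add: mon_deg_def)

lemma mon_deg_single [simp]: "mon_deg (Poly_Mapping.single i d) = d"
  by (cases "d = 0") (simp_all add: mon_deg_def)

lemma mon_deg_eq_0_iff: "mon_deg m = 0 \<longleftrightarrow> m = 0"
proof
  assume "mon_deg m = 0"
  then have "\<forall>i\<in>Poly_Mapping.keys m. Poly_Mapping.lookup m i = 0"
    by (simp add: mon_deg_def)
  then show "m = 0"
    by (intro poly_mapping_eqI) (auto simp: in_keys_iff)
qed simp

lemma polys_mono: "V \<subseteq> W \<Longrightarrow> polys V \<subseteq> polys W"
  by (auto simp: polys_def)

lemma forms_mono: "V \<subseteq> W \<Longrightarrow> forms V d \<subseteq> forms W d"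
  using polys_mono by (auto simp: forms_def)

lemma polys_0 [simp]: "0 \<in> polys V"
  and forms_0 [simp]: "0 \<in> forms V d"
  by (simp_all add: polys_def forms_def)

lemma polys_add: "p \<in> polys V \<Longrightarrow> q \<in> polys V \<Longrightarrow> p + q \<in> polys V"
  unfolding polys_def using keys_add[of p q] by auto

lemma forms_add: "p \<in> forms V d \<Longrightarrow> q \<in> forms V d \<Longrightarrow> p + q \<in> forms V d"
  unfolding forms_def using keys_add[of p q] polys_add by auto

lemma keys_uminus': "Poly_Mapping.keys (- p :: 'a \<Rightarrow>\<^sub>0 'b::ab_group_add) = Poly_Mapping.keys p"
  by (auto simp: in_keys_iff)

lemma polys_uminus: "p \<in> polys V \<Longrightarrow> - p \<in> polys V"
  for p :: "'k::ab_group_add mpol"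
  by (simp add: polys_def keys_uminus')

lemma forms_uminus: "p \<in> forms V d \<Longrightarrow> - p \<in> forms V d"
  for p :: "'k::ab_group_add mpol"
  by (simp add: polys_uminus forms_def keys_uminus')

lemma polys_diff: "p \<in> polys V \<Longrightarrow> q \<in> polys V \<Longrightarrow> p - q \<in> polys V"
  for p :: "'k::ab_group_add mpol"
  using polys_add[of p V "- q"] polys_uminus[of q V] by simp

lemma forms_diff: "p \<in> forms V d \<Longrightarrow> q \<in> forms V d \<Longrightarrow> p - q \<in> forms V d"
  for p :: "'k::ab_group_add mpol"
  using forms_add[of p V d "- q"] forms_uminus[of q V] by simp

lemma polys_sum: "(\<And>i. i \<in> I \<Longrightarrow> f i \<in> polys V) \<Longrightarrow> sum f I \<in> polys V"
  by (induction I rule: infinite_finite_induct) (auto intro: polys_add)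

lemma forms_sum: "(\<And>i. i \<in> I \<Longrightarrow> f i \<in> forms V d) \<Longrightarrow> sum f I \<in> forms V d"
  by (induction I rule: infinite_finite_induct) (auto intro: forms_add)

lemma polys_mult: "p \<in> polys V \<Longrightarrow> q \<in> polys V \<Longrightarrow> p * q \<in> polys V"
  for p :: "'k::semiring_0 mpol"
  unfolding polys_def using keys_mult[of p q] by (fastforce simp: keys_add_nat)

lemma forms_mult: "p \<in> forms V d \<Longrightarrow> q \<in> forms V e \<Longrightarrow> p * q \<in> forms V (d + e)"
  for p :: "'k::semiring_0 mpol"
  unfolding forms_def using keys_mult[of p q] polys_mult[of p V q] by (fastforce simp: mon_deg_add)

lemma cst_in_forms [simp]: "cst c \<in> forms V 0"
  by (auto simp: cst_def forms_def polys_def split: if_splits)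

lemma cst_in_polys [simp]: "cst c \<in> polys V"
  using cst_in_forms forms_subset_polys by blast

lemma var_in_forms: "i \<in> V \<Longrightarrow> var i \<in> forms V 1"
  by (auto simp: var_def forms_def polys_def split: if_splits)

lemma forms_cst_mult: "p \<in> forms V d \<Longrightarrow> cst c * p \<in> forms V d"
  for p :: "'k::semiring_0 mpol"
  using forms_mult[OF cst_in_forms] by fastforce

lemma cst_0 [simp]: "cst 0 = 0"
  and cst_1 [simp]: "cst 1 = (1 :: 'k::semiring_1 mpol)"
  by (simp_all add: cst_def)

lemma cst_add: "cst (a + b) = cst a + cst b"
  and cst_mult: "cst (c * d) = cst c * cst d"
  for a b :: "'a::monoid_add" and c d :: "'b::semiring_0"
  by (simp_all add: cst_def single_add mult_single)

lemma cst_uminus: "cst (- a) = - cst a"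
  and cst_diff: "cst (a - b) = cst a - cst b" for a b :: "'a::ab_group_add"
  by (simp_all add: cst_def single_uminus single_diff)

lemma cst_eq_0_iff [simp]: "cst a = 0 \<longleftrightarrow> a = 0"
  unfolding cst_def by (metis lookup_single_eq lookup_zero single_zero)

lemma form_0_is_cst:
  assumes "p \<in> forms V 0"
  obtains c where "p = cst c"
proof
  have "Poly_Mapping.lookup p m = 0" if "m \<noteq> 0" for m
    using assms that by (auto simp: forms_def mon_deg_eq_0_iff in_keys_iff)
  then show "p = cst (Poly_Mapping.lookup p 0)"
    by (intro poly_mapping_eqI) (auto simp: cst_def lookup_single when_def)
qed

lemma poly_mapping_expand:
  "p = (\<Sum>m\<in>Poly_Mapping.keys p. Poly_Mapping.single m (Poly_Mapping.lookup p m))"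
  by (intro poly_mapping_eqI) (auto simp: lookup_sum lookup_single when_def in_keys_iff)

lemma lookup_single_mult:
  fixes p :: "'k::semiring_0 mpol"
  shows "Poly_Mapping.lookup (Poly_Mapping.single a c * p) (a + m) = c * Poly_Mapping.lookup p m"
proof -
  have "Poly_Mapping.single a c * p
      = (\<Sum>k\<in>Poly_Mapping.keys p. Poly_Mapping.single (a + k) (c * Poly_Mapping.lookup p k))"
    by (subst poly_mapping_expand[of p]) (simp add: sum_distrib_left mult_single)
  then show ?thesis
    by (auto simp: lookup_sum lookup_single when_def in_keys_iff)
qed

lemma lookup_cst_mult: "Poly_Mapping.lookup (cst c * p) m = c * Poly_Mapping.lookup p m"
  for p :: "'k::semiring_0 mpol"
  using lookup_single_mult[of 0 c p m] by (simp add: cst_def)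

lemma lookup_var_mult:
  "Poly_Mapping.lookup (var i * p) (Poly_Mapping.single i 1 + m) = Poly_Mapping.lookup p m"
  for p :: "'k::semiring_1 mpol"
  by (simp add: var_def lookup_single_mult)

lemma lookup_var_mult_eq_0:
  fixes p :: "'k::semiring_1 mpol"
  assumes "Poly_Mapping.lookup m i = 0"
  shows "Poly_Mapping.lookup (var i * p) m = 0"
proof (rule ccontr)
  assume "\<not> ?thesis"
  then have "m \<in> Poly_Mapping.keys (var i * p)"
    by (simp add: in_keys_iff)
  then obtain b where "m = Poly_Mapping.single i 1 + b"
    using keys_mult[of "var i" p] by (auto simp: var_def split: if_splits)
  with assms show False
    by (simp add: lookup_add)
qed

lemma mon_deg_1:
  assumes "mon_deg m = 1"
  obtains i where "i \<in> Poly_Mapping.keys m" "m = Poly_Mapping.single i 1"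
proof -
  obtain i where i: "i \<in> Poly_Mapping.keys m"
    using assms by (metis mon_deg_def sum.empty zero_neq_one ex_in_conv)
  define k where "k = m - Poly_Mapping.single i 1"
  have "m = Poly_Mapping.single i 1 + k"
    using i by (intro poly_mapping_eqI)
      (auto simp: k_def lookup_add lookup_minus lookup_single when_def in_keys_iff)
  with assms have "k = 0"
    by (simp add: mon_deg_add mon_deg_eq_0_iff[symmetric])
  with \<open>m = _\<close> i that show ?thesis by simp
qed

lemma form_1_expand:
  fixes p :: "'k::semiring_1 mpol"
  assumes "finite V" "p \<in> forms V 1"
  shows "p = (\<Sum>i\<in>V. cst (Poly_Mapping.lookup p (Poly_Mapping.single i 1)) * var i)"
proof (rule poly_mapping_eqI)
  fix m
  have eq: "Poly_Mapping.lookup (\<Sum>i\<in>V. cst (Poly_Mapping.lookup p (Poly_Mapping.single i 1)) * var i) m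
    = (\<Sum>i\<in>V. Poly_Mapping.lookup p (Poly_Mapping.single i 1) when m = Poly_Mapping.single i 1)"
    by (auto simp: lookup_sum lookup_cst_mult var_def lookup_single when_def intro!: sum.cong)
  show "Poly_Mapping.lookup p m
    = Poly_Mapping.lookup (\<Sum>i\<in>V. cst (Poly_Mapping.lookup p (Poly_Mapping.single i 1)) * var i) m"
  proof (cases "Poly_Mapping.lookup p m = 0")
    case True
    then show ?thesis unfolding eq by (auto simp: when_def intro!: sum.neutral)
  next
    case False
    then have "m \<in> Poly_Mapping.keys p" by (simp add: in_keys_iff)
    with assms(2) have m: "mon_deg m = 1" "Poly_Mapping.keys m \<subseteq> V"
      by (auto simp: forms_def polys_def)
    then obtain i where i: "i \<in> V" "m = Poly_Mapping.single i 1"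
      by (metis mon_deg_1 subsetD)
    have "(Poly_Mapping.single i 1 = Poly_Mapping.single j (1::nat)) = (j = i)" for j
      by (metis lookup_single_eq lookup_single_not_eq zero_neq_one)
    then show ?thesis unfolding eq using i assms(1) by (simp add: when_def)
  qed
qed

section \<open>Homogeneous components\<close>

definition component :: "nat \<Rightarrow> 'k::comm_monoid_add mpol \<Rightarrow> 'k mpol" where
  "component d p = (\<Sum>m\<in>{m\<in>Poly_Mapping.keys p. mon_deg m = d}. Poly_Mapping.single m (Poly_Mapping.lookup p m))"

lemma lookup_component:
  "Poly_Mapping.lookup (component d p) m = (Poly_Mapping.lookup p m when mon_deg m = d)"
  by (auto simp: component_def lookup_sum lookup_single when_def in_keys_iff)

lemma component_add: "component d (p + q) = component d p + component d q"
  by (intro poly_mapping_eqI) (simp add: lookup_component lookup_add when_add_distrib)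

lemma component_0 [simp]: "component d 0 = 0"
  by (intro poly_mapping_eqI) (simp add: lookup_component)

lemma component_sum: "component d (sum f I) = (\<Sum>i\<in>I. component d (f i))"
  by (induction I rule: infinite_finite_induct) (auto simp: component_add)

lemma component_in_forms: "p \<in> polys V \<Longrightarrow> component d p \<in> forms V d"
  by (auto simp: forms_def polys_def in_keys_iff lookup_component)

lemma component_form:
  "p \<in> forms V e \<Longrightarrow> component d p = (if d = e then p else 0)"
  by (intro poly_mapping_eqI) (auto simp: forms_def lookup_component when_def in_keys_iff)

text \<open>Only the component of \<open>p\<close> in degree \<open>d - e\<close> can contribute, as
  \<open>q\<close> is homogeneous. The case distinction is needed because \<open>d - e\<close> is
  truncated at 0.\<close>

lemma component_mult:
  fixes p :: "'k::comm_ring_1 mpol"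
  assumes "q \<in> forms V e"
  shows "component d (p * q) = (if e \<le> d then component (d - e) p * q else 0)"
proof (rule poly_mapping_eqI)
  fix m
  have *: "a * q \<in> forms UNIV (c + e)" if "a \<in> forms UNIV c" for a c
    using assms that forms_mono[of V UNIV] by (auto intro: forms_mult)
  have p: "p = (\<Sum>c\<in>mon_deg ` Poly_Mapping.keys p. component c p)"
    by (rule poly_mapping_eqI) (auto simp: lookup_sum lookup_component when_def in_keys_iff)
  have eq: "component d (p * q)
      = (\<Sum>c\<in>mon_deg ` Poly_Mapping.keys p. if d = c + e then component c p * q else 0)"
    by (subst p, unfold sum_distrib_right component_sum)
      (intro sum.cong refl component_form[where V = UNIV] * component_in_forms, simp add: polys_def)
  show "Poly_Mapping.lookup (component d (p * q)) m
    = Poly_Mapping.lookup (if e \<le> d then component (d - e) p * q else 0) m"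
  proof (cases "e \<le> d")
    case True
    then have "d = c + e \<longleftrightarrow> c = d - e" for c by auto
    moreover have "component (d - e) p = 0" if "d - e \<notin> mon_deg ` Poly_Mapping.keys p"
    proof (rule poly_mapping_eqI)
      fix k
      have "Poly_Mapping.lookup p k = 0" if "mon_deg k = d - e"
        using that \<open>d - e \<notin> _\<close> by (metis image_eqI in_keys_iff)
      then show "Poly_Mapping.lookup (component (d - e) p) k = Poly_Mapping.lookup 0 k"
        by (simp add: lookup_component when_def)
    qed
    ultimately show ?thesis using True unfolding eq by (auto simp: sum.delta)
  next
    case False
    then show ?thesis unfolding eq by (auto intro!: sum.neutral)
  qed
qed


section \<open>Linear pencils\<close>

text \<open>This is the independence of eigenvectors, for a pencil. \<open>L\<close> and
  \<open>M\<close> induce maps from \<open>V\<close> modulo \<open>V0\<close> to the target modulo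
  \<open>J\<close>, the one of \<open>L\<close> being injective. On a kernel vector
  \<open>v t\<close> of \<open>L + t M\<close>, the map \<open>L + s M\<close> acts as (1 - s/t)
  \<open>L\<close> modulo \<open>J\<close>. Hence kernel vectors for distinct \<open>t\<close> are
  independent modulo \<open>V0\<close>, and there are at most \<open>card B\<close> of them.
  Carrying \<open>V0\<close> and \<open>J\<close> along avoids quotient spaces.\<close>

lemma (in vector_space_pair) finite_degenerate_members_of_pencil:
  assumes L: "Vector_Spaces.linear s1 s2 L" and M: "Vector_Spaces.linear s1 s2 M"
    and V: "vs1.subspace V" "finite B" "V \<subseteq> vs1.span B"
    and V0: "vs1.subspace V0" and J: "vs2.subspace J"
    and V0J: "\<And>v. v \<in> V0 \<Longrightarrow> L v \<in> J" "\<And>v. v \<in> V0 \<Longrightarrow> M v \<in> J"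
    and inj: "\<And>v. v \<in> V \<Longrightarrow> L v \<in> J \<Longrightarrow> v \<in> V0"
  shows "finite {t. \<exists>v\<in>V. v \<notin> V0 \<and> L v + s2 t (M v) \<in> J}"
proof -
  interpret L: Vector_Spaces.linear s1 s2 L by (rule L)
  interpret M: Vector_Spaces.linear s1 s2 M by (rule M)
  define T where "T = {t. \<exists>v\<in>V. v \<notin> V0 \<and> L v + s2 t (M v) \<in> J}"
  define v where "v t = (SOME v. v \<in> V \<and> v \<notin> V0 \<and> L v + s2 t (M v) \<in> J)" for t
  have v: "v t \<in> V" "v t \<notin> V0" "L (v t) + s2 t (M (v t)) \<in> J" if "t \<in> T" for t
  proof -
    have "\<exists>v. v \<in> V \<and> v \<notin> V0 \<and> L v + s2 t (M v) \<in> J" using that unfolding T_def by blast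
    from someI_ex[OF this] show "v t \<in> V" "v t \<notin> V0" "L (v t) + s2 t (M (v t)) \<in> J"
      unfolding v_def by blast+
  qed
  have t0: "t \<noteq> 0" if "t \<in> T" for t
  proof
    assume "t = 0"
    with v[OF that] inj[of "v t"] show False by simp
  qed
  have indep: "\<forall>t\<in>F. a t = 0"
    if "finite F" "F \<subseteq> T" "(\<Sum>t\<in>F. s1 (a t) (v t)) \<in> V0" for F a
    using that
  proof (induction F arbitrary: a rule: finite_induct)
    case (insert s F)
    define u where "u = (\<Sum>t\<in>insert s F. s1 (a t) (v t))"
    have "u \<in> V0" using insert.prems by (simp only: u_def)
    \<comment> \<open>The relation at \<open>t\<close>, scaled so that it trades s M (v t) for
      -(s/t) L (v t).\<close>
    define E where "E t = s2 (a t * (s / t)) (L (v t) + s2 t (M (v t)))" for t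
    have E: "E t \<in> J" if "t \<in> insert s F" for t
    proof -
      have "t \<in> T" using insert.prems(1) that by blast
      then show ?thesis unfolding E_def by (intro vs2.subspace_scale[OF J] v(3))
    qed
    \<comment> \<open>The term at \<open>s\<close> would carry the factor 1 - s/s = 0, so
      \<open>y\<close> is a combination over \<open>F\<close> alone and the induction hypothesis
      applies to it.\<close>
    define y where "y = (\<Sum>t\<in>F. s1 (a t * (1 - s / t)) (v t))"
    have "L u + s2 s (M u) = (\<Sum>t\<in>insert s F. s2 (a t) (L (v t) + s2 s (M (v t))))"
      unfolding u_def L.sum M.sum L.scale M.scale vs2.scale_sum_right sum.distrib[symmetric]
      by (intro sum.cong refl) (simp add: vs2.scale_right_distrib mult.commute)
    also have "\<dots> = (\<Sum>t\<in>insert s F. s2 (a t * (1 - s / t)) (L (v t)) + E t)"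
    proof (intro sum.cong refl)
      fix t assume "t \<in> insert s F"
      then have "t \<noteq> 0" using t0 insert.prems(1) by blast
      have "s2 (a t) (L (v t)) = s2 (a t * (1 - s / t)) (L (v t)) + s2 (a t * (s / t)) (L (v t))"
      proof -
        have "a t = a t * (1 - s / t) + a t * (s / t)" by (simp add: right_diff_distrib)
        then show ?thesis by (metis vs2.scale_left_distrib)
      qed
      then show "s2 (a t) (L (v t) + s2 s (M (v t))) = s2 (a t * (1 - s / t)) (L (v t)) + E t"
        using \<open>t \<noteq> 0\<close> by (simp add: E_def vs2.scale_right_distrib)
    qed
    also have "\<dots> = L y + sum E (insert s F)"
    proof -
      have "s \<noteq> 0" using t0 insert.prems(1) by blast
      then show ?thesis
        using insert.hyps by (simp add: sum.distrib y_def L.sum L.scale)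
    qed
    finally have "L y = L u + s2 s (M u) - sum E (insert s F)" by simp
    moreover have "sum E (insert s F) \<in> J"
      using E by (intro vs2.subspace_sum[OF J]) auto
    ultimately have "L y \<in> J"
      using \<open>u \<in> V0\<close> V0J J by (simp add: vs2.subspace_add vs2.subspace_diff vs2.subspace_scale)
    moreover have "y \<in> V"
      unfolding y_def using insert.prems(1)
      by (intro vs1.subspace_sum[OF V(1)] vs1.subspace_scale[OF V(1)] v(1)) auto
    ultimately have "y \<in> V0" using inj by blast
    then have "\<forall>t\<in>F. a t * (1 - s / t) = 0"
      using insert.prems(1) unfolding y_def by (intro insert.IH) auto
    moreover have "1 - s / t \<noteq> 0" if "t \<in> F" for t
    proof -
      have "t \<noteq> s" using that insert.hyps(2) by blast
      moreover have "t \<noteq> 0" using t0 that insert.prems(1) by blast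
      ultimately show ?thesis by (simp add: field_simps)
    qed
    ultimately have aF: "\<forall>t\<in>F. a t = 0" by (metis mult_eq_0_iff)
    then have "s1 (a s) (v s) \<in> V0"
      using insert.prems(2) insert.hyps by simp
    then have *: "s1 (inverse (a s)) (s1 (a s) (v s)) \<in> V0"
      by (rule vs1.subspace_scale[OF V0])
    have "v s \<notin> V0" using v(2) insert.prems(1) by blast
    with * have "a s = 0" by (cases "a s = 0") simp_all
    with aF show ?case by simp
  qed simp
  have "card F \<le> card B" if F: "F \<subseteq> T" "finite F" for F
  proof -
    have "inj_on v F"
    proof (rule inj_onI, rule ccontr)
      fix s t assume st: "s \<in> F" "t \<in> F" "v s = v t" "s \<noteq> t"
      have "(\<Sum>r\<in>{s,t}. s1 (if r = s then 1 else -1) (v r)) = 0"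
        using st by simp
      then have "\<forall>r\<in>{s,t}. (if r = s then 1 else -1) = (0::'a)"
        using st F(1) vs1.subspace_0[OF V0] by (intro indep) auto
      then show False by simp
    qed
    moreover have "vs1.independent (v ` F)"
    proof (rule vs1.independent_if_scalars_zero)
      fix f x assume fx: "(\<Sum>x\<in>v ` F. s1 (f x) x) = 0" "x \<in> v ` F"
      have "(\<Sum>t\<in>F. s1 (f (v t)) (v t)) = 0"
        using fx(1) \<open>inj_on v F\<close> by (simp add: sum.reindex)
      then have "\<forall>t\<in>F. f (v t) = 0"
        using F vs1.subspace_0[OF V0] by (intro indep) auto
      with fx(2) show "f x = 0" by auto
    qed (use F in simp)
    moreover have "v ` F \<subseteq> vs1.span B" using v F(1) V(3) by blast
    ultimately show ?thesis
      using vs1.independent_span_bound[OF V(2)] by (metis card_image)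
  qed
  then show ?thesis
    using finite_if_finite_subsets_card_bdd unfolding T_def by blast
qed

section \<open>Polynomials as a vector space over the coefficient field\<close>

global_interpretation mpol: vector_space "\<lambda>c p. cst c * p :: 'k::field mpol"
  by standard (simp_all add: distrib_left distrib_right cst_add cst_mult mult.assoc)

\<comment> \<open>loops with \<open>cst_mult\<close>\<close>
declare mpol.scale_scale [simp del]

lemma subspace_forms: "mpol.subspace (forms V d)"
  by (auto intro!: mpol.subspaceI forms_add forms_cst_mult)

lemma lookup_var: "Poly_Mapping.lookup (var i) (Poly_Mapping.single j 1) = (if i = j then 1 else 0)"
proof -
  have "(Poly_Mapping.single i 1 = Poly_Mapping.single j (1::nat)) = (i = j)"
    by (metis lookup_single_eq lookup_single_not_eq zero_neq_one)
  then show ?thesis by (simp add: var_def lookup_single when_def)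
qed

lemmas lookup_var_Suc [simp] = lookup_var[unfolded One_nat_def]

lemma var_neq_0: "var i \<noteq> 0"
  by (metis lookup_var lookup_zero zero_neq_one)

lemma forms_1_subset_span:
  assumes "finite V"
  shows "forms V 1 \<subseteq> (mpol.span (var ` V) :: 'k::field mpol set)"
proof
  fix p :: "'k mpol" assume "p \<in> forms V 1"
  then have "p = (\<Sum>i\<in>V. cst (Poly_Mapping.lookup p (Poly_Mapping.single i 1)) * var i)"
    using form_1_expand assms by blast
  moreover have "(\<Sum>i\<in>V. cst (Poly_Mapping.lookup p (Poly_Mapping.single i 1)) * var i) \<in> mpol.span (var ` V)"
    by (intro mpol.span_sum mpol.span_scale mpol.span_base imageI)
  ultimately show "p \<in> mpol.span (var ` V)" by (rule ssubst)
qed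

section \<open>Quadrics whose low degree syzygies are Koszul\<close>

text \<open>The two syzygy conditions are the low degree trace of the exactness of the Koszul
  complex. Koszul syzygies have entries in the ideal, so linear entries vanish and quadratic entries
  are constant combinations of the quadrics. Being statements about forms only, they can be checked
  in a quotient by lifting coefficients.\<close>

locale quadrics =
  fixes V I :: "nat set" and q :: "nat \<Rightarrow> 'k::field mpol"
  assumes finite_V: "finite V" and finite_I: "finite I"
    and q_in_forms: "i \<in> I \<Longrightarrow> q i \<in> forms V 2"
    and linear_syzygy: "\<And>a i. (\<And>i. i \<in> I \<Longrightarrow> a i \<in> forms V 1) \<Longrightarrow> (\<Sum>i\<in>I. a i * q i) = 0
      \<Longrightarrow> i \<in> I \<Longrightarrow> a i = 0"
    and quadratic_syzygy: "\<And>a i. (\<And>i. i \<in> I \<Longrightarrow> a i \<in> forms V 2) \<Longrightarrow> (\<Sum>i\<in>I. a i * q i) = 0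
      \<Longrightarrow> i \<in> I \<Longrightarrow> \<exists>c. a i = (\<Sum>j\<in>I. cst (c j) * q j)"
begin

text \<open>Degree 2 of the ideal, so for linear forms \<open>x * y \<in> qspan\<close> reads x y =
  0 in the quotient algebra.\<close>

definition qspan :: "'k mpol set" where
  "qspan = {f. \<exists>c. f = (\<Sum>i\<in>I. cst (c i) * q i)}"

lemma subspace_qspan: "mpol.subspace qspan"
proof (rule mpol.subspaceI)
  show "0 \<in> qspan" unfolding qspan_def by (auto intro: exI[of _ "\<lambda>_. 0"])
next
  fix f g assume "f \<in> qspan" "g \<in> qspan"
  then obtain c d where "f = (\<Sum>i\<in>I. cst (c i) * q i)" "g = (\<Sum>i\<in>I. cst (d i) * q i)"
    by (auto simp: qspan_def)
  then have "f + g = (\<Sum>i\<in>I. cst (c i + d i) * q i)"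
    by (simp add: cst_add distrib_right sum.distrib)
  then show "f + g \<in> qspan" by (auto simp: qspan_def)
next
  fix a f assume "f \<in> qspan"
  then obtain c where "f = (\<Sum>i\<in>I. cst (c i) * q i)" by (auto simp: qspan_def)
  then have "cst a * f = (\<Sum>i\<in>I. cst (a * c i) * q i)"
    by (simp add: cst_mult sum_distrib_left mult.assoc del: mpol.scale_scale)
  then show "cst a * f \<in> qspan" by (auto simp: qspan_def)
qed

text \<open>Comparing (x y) z with (x z) y gives the linear syzygy with entries c_i z - d_i y, which
  must vanish. Some c_i is nonzero because \<open>x * y\<close> is a nonzero polynomial. So the
  kernel of a nonzero linear form in degree 1 is at most a line.\<close>

lemma linear_annihilator_unique:
  assumes "x \<in> forms V 1" "y \<in> forms V 1" "z \<in> forms V 1" "x \<noteq> 0" "y \<noteq> 0"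
    and "x * y \<in> qspan" "x * z \<in> qspan"
  obtains c where "z = cst c * y"
proof -
  obtain c d where c: "x * y = (\<Sum>i\<in>I. cst (c i) * q i)" and d: "x * z = (\<Sum>i\<in>I. cst (d i) * q i)"
    using assms(6,7) by (auto simp: qspan_def)
  have "(\<Sum>i\<in>I. (cst (c i) * z - cst (d i) * y) * q i) = x * y * z - x * z * y"
    unfolding c d by (simp add: sum_distrib_left sum_subtractf algebra_simps)
  then have "(\<Sum>i\<in>I. (cst (c i) * z - cst (d i) * y) * q i) = 0"
    by (simp add: algebra_simps)
  then have eq: "cst (c i) * z - cst (d i) * y = 0" if "i \<in> I" for i
    using that assms(2,3)
    by (intro linear_syzygy[where a = "\<lambda>i. cst (c i) * z - cst (d i) * y"])
      (auto intro: forms_diff forms_cst_mult)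
  have "\<exists>i\<in>I. c i \<noteq> 0"
  proof (rule ccontr)
    assume "\<not> ?thesis"
    then have "x * y = 0" unfolding c by (intro sum.neutral) auto
    with assms show False by simp
  qed
  then obtain i where i: "i \<in> I" "c i \<noteq> 0" by blast
  have "cst (inverse (c i)) * (cst (c i) * z) = cst (inverse (c i)) * (cst (d i) * y)"
    using eq[OF i(1)] by simp
  then have "z = cst (inverse (c i) * d i) * y"
    using i(2) by (simp add: mult.assoc[symmetric] cst_mult[symmetric])
  then show thesis by (rule that)
qed

text \<open>A chase through the double complex formed by the Koszul complexes of the variables and of the
  quadrics: the entries \<open>b\<close> sit in degree 0, one step before they vanish for degree reasons.\<close>
lemma socle_degree_2:
  assumes "card V \<ge> 3"
    and a: "\<And>i j. i \<in> V \<Longrightarrow> j \<in> I \<Longrightarrow> a i j \<in> forms V 1"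
    and f: "\<And>i. i \<in> V \<Longrightarrow> var i * f = (\<Sum>j\<in>I. a i j * q j)"
  shows "f \<in> qspan"
proof -
  \<comment> \<open>The syzygy expresses x_k (x_i f) = x_i (x_k f).\<close>
  have ex: "\<exists>c. var k * a i j - var i * a k j = (\<Sum>l\<in>I. cst (c l) * q l)"
    if "i \<in> V" "k \<in> V" "j \<in> I" for i k j
  proof (rule quadratic_syzygy[OF _ _ that(3)])
    show "var k * a i j - var i * a k j \<in> forms V 2" if "j \<in> I" for j
    proof -
      have "var k * a i j \<in> forms V (1 + 1)" "var i * a k j \<in> forms V (1 + 1)"
        using \<open>i \<in> V\<close> \<open>k \<in> V\<close> that by (intro forms_mult a var_in_forms; simp)+
      then show ?thesis by (simp add: forms_diff numeral_2_eq_2)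
    qed
    have "(\<Sum>j\<in>I. (var k * a i j - var i * a k j) * q j)
        = var k * (\<Sum>j\<in>I. a i j * q j) - var i * (\<Sum>j\<in>I. a k j * q j)"
      by (simp add: sum_distrib_left sum_subtractf algebra_simps)
    also have "\<dots> = 0" using that by (simp add: f[symmetric] mult.left_commute)
    finally show "(\<Sum>j\<in>I. (var k * a i j - var i * a k j) * q j) = 0" .
  qed
  define b where "b i k j = (SOME c. var k * a i j - var i * a k j = (\<Sum>l\<in>I. cst (c l) * q l))" for i k j
  have b: "var k * a i j - var i * a k j = (\<Sum>l\<in>I. cst (b i k j l) * q l)"
    if "i \<in> V" "k \<in> V" "j \<in> I" for i k j
    unfolding b_def using someI_ex[OF ex[OF that]] .
  \<comment> \<open>For three distinct variables the cyclic sum of x_m (x_k a_i - x_i a_k) cancels.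
    It leaves a linear syzygy with entries \<open>?c l\<close>, in which \<open>b i k j l\<close> is
    the coefficient of x_m. This is where a third variable is required.\<close>
  have b0: "b i k j l = 0"
    if "i \<in> V" "k \<in> V" "m \<in> V" "m \<noteq> i" "m \<noteq> k" "i \<noteq> k" "j \<in> I" "l \<in> I" for i k m j l
  proof -
    let ?c = "\<lambda>l. cst (b i k j l) * var m + cst (b k m j l) * var i + cst (b m i j l) * var k"
    have "(\<Sum>l\<in>I. ?c l * q l) = var m * (\<Sum>l\<in>I. cst (b i k j l) * q l)
        + var i * (\<Sum>l\<in>I. cst (b k m j l) * q l) + var k * (\<Sum>l\<in>I. cst (b m i j l) * q l)"
      by (simp add: sum_distrib_left sum.distrib algebra_simps)
    also have "\<dots> = 0"
      unfolding b[OF that(1,2,7), symmetric] b[OF that(2,3,7), symmetric] b[OF that(3,1,7), symmetric]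
      by (simp add: algebra_simps)
    finally have "?c l = 0"
      using that by (intro linear_syzygy[where a = ?c]) (auto intro!: forms_add forms_cst_mult var_in_forms var_in_forms[unfolded One_nat_def])
    then have "Poly_Mapping.lookup (?c l) (Poly_Mapping.single m 1) = 0" by simp
    then show ?thesis
      using that by (auto simp: lookup_add lookup_cst_mult lookup_var)
  qed
  have comm: "var k * a i j = var i * a k j" if "i \<in> V" "k \<in> V" "i \<noteq> k" "j \<in> I" for i k j
  proof -
    have "card {i, k} < card V" using assms(1) that by simp
    then have "\<not> V \<subseteq> {i, k}"
      by (metis card_mono finite.emptyI finite.insertI not_less)
    then obtain m where "m \<in> V" "m \<noteq> i" "m \<noteq> k" by blast
    then have "(\<Sum>l\<in>I. cst (b i k j l) * q l) = 0"
      using that by (intro sum.neutral) (simp add: b0)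
    with b[of i k j] that show ?thesis by simp
  qed
  obtain i where i: "i \<in> V" using assms(1) by (metis card.empty ex_in_conv not_numeral_le_zero)
  have "card {i} < card V" using assms(1) by simp
  then have "\<not> V \<subseteq> {i}"
    by (metis card_mono finite.emptyI finite.insertI not_less)
  then obtain k where k: "k \<in> V" "k \<noteq> i" by blast
  \<comment> \<open>By \<open>comm\<close>, \<open>var i\<close> divides
    \<open>var k * a i j\<close> and hence the linear form \<open>a i j\<close>, which is thus a
    constant multiple of \<open>var i\<close>. Cancelling \<open>var i\<close> in the equation for
    \<open>var i * f\<close> then exhibits \<open>f\<close>.\<close>
  define c where "c j = Poly_Mapping.lookup (a i j) (Poly_Mapping.single i 1)" for j
  have "a i j = cst (c j) * var i" if "j \<in> I" for j
  proof -
    have "Poly_Mapping.lookup (a i j) (Poly_Mapping.single l 1) = 0" if "l \<noteq> i" for l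
    proof -
      have "Poly_Mapping.lookup (a i j) (Poly_Mapping.single l 1)
          = Poly_Mapping.lookup (var i * a k j) (Poly_Mapping.single k 1 + Poly_Mapping.single l 1)"
        using comm[of i k j] i k \<open>j \<in> I\<close> by (metis lookup_var_mult)
      also have "\<dots> = 0"
        using that k by (intro lookup_var_mult_eq_0) (auto simp: lookup_add lookup_single when_def)
      finally show ?thesis .
    qed
    then have "(\<Sum>l\<in>V. cst (Poly_Mapping.lookup (a i j) (Poly_Mapping.single l 1)) * var l)
      = (\<Sum>l\<in>V. if l = i then cst (c j) * var i else 0)"
      by (intro sum.cong) (auto simp: c_def)
    then show ?thesis
      using form_1_expand[OF finite_V a[OF i that]] i finite_V by simp
  qed
  then have "var i * f = var i * (\<Sum>j\<in>I. cst (c j) * q j)"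
    using f[OF i] by (simp add: sum_distrib_left algebra_simps)
  then have "f = (\<Sum>j\<in>I. cst (c j) * q j)"
    by (simp add: var_neq_0)
  then show ?thesis by (auto simp: qspan_def)
qed

lemma exists_injective_linear_form:
  assumes card: "card V \<ge> 3" and inf: "infinite (UNIV :: 'k set)" and char: "(2::'k) \<noteq> 0"
  shows "\<exists>x\<in>forms V 1. \<forall>y\<in>forms V 1. x * y \<in> qspan \<longrightarrow> y = 0"
proof (rule ccontr)
  assume "\<not> ?thesis"
  then have noninj: "\<exists>y\<in>forms V 1. x * y \<in> qspan \<and> y \<noteq> 0" if "x \<in> forms V 1" for x
    using that by blast
  interpret pair: vector_space_pair "\<lambda>c p :: 'k mpol. cst c * p" "\<lambda>c p :: 'k mpol. cst c * p"
    by unfold_locales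
  note sub = mpol.subspace_add[OF subspace_qspan] mpol.subspace_diff[OF subspace_qspan]
    mpol.subspace_scale[OF subspace_qspan]
  have square: "x * x \<in> qspan" if x: "x \<in> forms V 1" "x \<noteq> 0" for x
  proof -
    obtain y where y: "y \<in> forms V 1" "x * y \<in> qspan" "y \<noteq> 0"
      using noninj[OF x(1)] by blast
    \<comment> \<open>If x' y were not in x A^1, some x + t x' would be injective. Since x y = 0 in
      the quotient, x + t x' sends y/t to x' y. Rescaling the direction of \<open>y\<close> by 1/t
      therefore turns x + t x' into a pencil \<open>L + t M\<close> whose member \<open>L\<close> at
      t = 0 is already injective.\<close>
    have tangent: "\<exists>u\<in>forms V 1. x' * y - x * u \<in> qspan" if x': "x' \<in> forms V 1" for x'
    proof (rule ccontr)
      assume no: "\<not> ?thesis"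
      obtain i where i: "i \<in> V" "Poly_Mapping.lookup y (Poly_Mapping.single i 1) \<noteq> 0"
      proof (rule ccontr)
        assume "\<not> thesis"
        then have "(\<Sum>i\<in>V. cst (Poly_Mapping.lookup y (Poly_Mapping.single i 1)) * var i) = 0"
          using that by (intro sum.neutral) auto
        with form_1_expand[OF finite_V y(1)] y(3) show False by simp
      qed
      define r where "r = Poly_Mapping.lookup y (Poly_Mapping.single i 1)"
      \<comment> \<open>A coordinate functional normalised by \<phi> y = 1; it splits
        \<open>v\<close> into a part with vanishing coordinate and a multiple of
        \<open>y\<close>.\<close>
      define \<phi> :: "'k mpol \<Rightarrow> 'k" where "\<phi> v = Poly_Mapping.lookup v (Poly_Mapping.single i 1) / r" for v
      have \<phi>_add: "\<phi> (u + v) = \<phi> u + \<phi> v" and \<phi>_scale: "\<phi> (cst c * v) = c * \<phi> v" for u v c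
        by (simp_all add: \<phi>_def lookup_add lookup_cst_mult add_divide_distrib)
      have \<phi>_scale': "\<phi> (v * cst c) = c * \<phi> v" for v c
        using \<phi>_scale by (simp add: mult.commute)
      have \<phi>_y: "\<phi> y = 1" using i by (simp add: \<phi>_def r_def)
      define L where "L v = x * (v - cst (\<phi> v) * y) + cst (\<phi> v) * (x' * y)" for v
      define M where "M v = x' * (v - cst (\<phi> v) * y)" for v
      have fin: "finite {t. \<exists>v\<in>forms V 1. v \<notin> {0} \<and> L v + cst t * M v \<in> qspan}"
      proof (rule pair.finite_degenerate_members_of_pencil[OF _ _ subspace_forms _
            forms_1_subset_span[OF finite_V] _ subspace_qspan])
        show "Vector_Spaces.linear (\<lambda>c p. cst c * p) (\<lambda>c p. cst c * p) L"
          by standard (simp_all add: L_def \<phi>_add \<phi>_scale \<phi>_scale' cst_add cst_mult algebra_simps)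
        show "Vector_Spaces.linear (\<lambda>c p. cst c * p) (\<lambda>c p. cst c * p) M"
          by standard (simp_all add: M_def \<phi>_add \<phi>_scale \<phi>_scale' cst_add cst_mult algebra_simps)
        fix v assume v: "v \<in> forms V 1" "L v \<in> qspan"
        have "\<phi> v = 0"
        proof (rule ccontr)
          assume nz: "\<phi> v \<noteq> 0"
          define u where "u = cst (- inverse (\<phi> v)) * (v - cst (\<phi> v) * y)"
          have "cst (inverse (\<phi> v)) * L v = (cst (inverse (\<phi> v)) * cst (\<phi> v)) * (x' * y) - x * u"
            by (simp add: L_def u_def cst_uminus algebra_simps)
          then have "x' * y - x * u = cst (inverse (\<phi> v)) * L v"
            using nz by (simp add: cst_mult[symmetric])
          then have "x' * y - x * u \<in> qspan" using v(2) sub by simp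
          moreover have "u \<in> forms V 1"
            unfolding u_def by (intro forms_cst_mult forms_diff v y)
          ultimately show False using no by blast
        qed
        then have "x * v \<in> qspan" using v(2) by (simp add: L_def)
        then obtain c where c: "v = cst c * y"
          using linear_annihilator_unique x y v(1) by metis
        then have "c = 0" using \<open>\<phi> v = 0\<close> by (simp add: \<phi>_scale \<phi>_y)
        with c show "v \<in> {0}" by simp
      qed (auto simp: finite_V L_def M_def \<phi>_def mpol.subspace_0[OF subspace_qspan]
          intro!: mpol.subspaceI)
      \<comment> \<open>The value 0 is excluded too, because the rescaling divides by
        \<open>t\<close>.\<close>
      then have "finite (insert 0 {t. \<exists>v\<in>forms V 1. v \<notin> {0} \<and> L v + cst t * M v \<in> qspan})"
        by simp
      then obtain t where t: "t \<noteq> 0" "\<And>v. v \<in> forms V 1 \<Longrightarrow> L v + cst t * M v \<in> qspan \<Longrightarrow> v = 0"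
        using ex_new_if_finite[OF inf] by blast
      have "x + cst t * x' \<in> forms V 1" using x x' by (intro forms_add forms_cst_mult)
      then obtain z where z: "z \<in> forms V 1" "(x + cst t * x') * z \<in> qspan" "z \<noteq> 0"
        using noninj by blast
      \<comment> \<open>This is \<open>z\<close> with its coordinate along \<open>y\<close>
        multiplied by \<open>t\<close>, which undoes the rescaling: \<open>L v + t M v\<close> is (x
        + t x') z up to a multiple of \<open>x * y\<close>.\<close>
      define v where "v = z + cst (t * \<phi> z - \<phi> z) * y"
      have \<phi>v: "\<phi> v = t * \<phi> z" by (simp add: v_def \<phi>_add \<phi>_scale \<phi>_y)
      have "L v + cst t * M v = (x + cst t * x') * z - cst (\<phi> z) * (x * y)"
        unfolding L_def M_def \<phi>v unfolding v_def by (simp add: cst_diff cst_mult algebra_simps)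
      then have "L v + cst t * M v \<in> qspan" using z(2) y(2) sub by simp
      moreover have "v \<in> forms V 1" unfolding v_def by (intro forms_add forms_cst_mult z y)
      ultimately have "v = 0" using t(2) by blast
      then have "\<phi> z = 0" using \<phi>v t(1) by (simp add: \<phi>_def)
      with \<open>v = 0\<close> z(3) show False by (simp add: v_def)
    qed
    obtain d where d: "x * y = (\<Sum>j\<in>I. cst (d j) * q j)" using y(2) by (auto simp: qspan_def)
    have "\<exists>a. (\<forall>j\<in>I. a j \<in> forms V 1) \<and> var i * (y * y) = (\<Sum>j\<in>I. a j * q j)" if i: "i \<in> V" for i
    proof -
      obtain u c where u: "u \<in> forms V 1" "var i * y - x * u = (\<Sum>j\<in>I. cst (c j) * q j)"
        using tangent[OF var_in_forms[OF i]] by (auto simp: qspan_def)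
      \<comment> \<open>Both \<open>x * y\<close> and \<open>var i * y - x * u\<close> lie in the
        ideal, so every variable kills the square of \<open>y\<close>.\<close>
      have "var i * (y * y) = u * (x * y) + y * (var i * y - x * u)" by (simp add: algebra_simps)
      also have "\<dots> = (\<Sum>j\<in>I. (cst (d j) * u + cst (c j) * y) * q j)"
        unfolding u(2) d by (simp add: sum_distrib_left sum.distrib algebra_simps)
      finally show ?thesis
        using u(1) y(1)
        by (intro exI[of _ "\<lambda>j. cst (d j) * u + cst (c j) * y"]) (auto intro!: forms_add forms_cst_mult)
    qed
    then obtain a where "\<And>i j. i \<in> V \<Longrightarrow> j \<in> I \<Longrightarrow> a i j \<in> forms V 1"
      "\<And>i. i \<in> V \<Longrightarrow> var i * (y * y) = (\<Sum>j\<in>I. a i j * q j)"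
      by metis
    then have "y * y \<in> qspan" by (rule socle_degree_2[OF card])
    moreover have "y * x \<in> qspan" using y(2) by (simp add: mult.commute)
    ultimately obtain c where "x = cst c * y"
      using linear_annihilator_unique[OF y(1) y(1) x(1) y(3,3)] by metis
    then have "x * x = cst c * (x * y)" by (simp add: algebra_simps)
    then show ?thesis using sub(3)[OF y(2), of c] by (simp only:)
  qed
  obtain i where i: "i \<in> V" using card by (metis card.empty ex_in_conv not_numeral_le_zero)
  have "card {i} < card V" using card by simp
  then have "\<not> V \<subseteq> {i}"
    by (metis card_mono finite.emptyI finite.insertI not_less)
  then obtain k where k: "k \<in> V" "k \<noteq> i" by blast
  \<comment> \<open>Polarising the squares puts the product of two distinct variables into
    \<open>qspan\<close>. Then \<open>var i\<close> annihilates two independent linear forms,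
    against the uniqueness of the annihilator.\<close>
  let ?x = "var i :: 'k mpol" and ?y = "var k :: 'k mpol"
  have xy: "?x \<in> forms V 1" "?y \<in> forms V 1" using i k var_in_forms by blast+
  have "Poly_Mapping.lookup (?x + ?y) (Poly_Mapping.single i 1) = 1"
    using k by (simp add: lookup_add lookup_var)
  then have "?x + ?y \<noteq> 0" by auto
  then have "(?x + ?y) * (?x + ?y) \<in> qspan" by (intro square forms_add xy)
  then have "(?x + ?y) * (?x + ?y) - ?x * ?x - ?y * ?y \<in> qspan"
    by (rule sub(2)[OF sub(2)[OF _ square[OF xy(1) var_neq_0]] square[OF xy(2) var_neq_0]])
  moreover have "(?x + ?y) * (?x + ?y) - ?x * ?x - ?y * ?y = cst 2 * (?x * ?y)"
    by (simp add: cst_def algebra_simps)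
  ultimately have "cst (inverse 2) * (cst 2 * (?x * ?y)) \<in> qspan" using sub by metis
  then have "?x * ?y \<in> qspan"
    using char by (simp add: mult.assoc[symmetric] cst_mult[symmetric])
  moreover have "?x * ?x \<in> qspan" using square xy var_neq_0 by blast
  ultimately obtain c where "?y = cst c * ?x"
    using linear_annihilator_unique xy var_neq_0 by metis
  then have "Poly_Mapping.lookup ?y (Poly_Mapping.single k 1)
    = Poly_Mapping.lookup (cst c * ?x) (Poly_Mapping.single k 1)" by simp
  then show False using k by (simp add: lookup_var lookup_cst_mult)
qed

end

section \<open>Dimensions of spaces of forms\<close>

lemma card_monomials:
  assumes "finite V"
  defines "M \<equiv> \<lambda>d. {m :: nat \<Rightarrow>\<^sub>0 nat. Poly_Mapping.keys m \<subseteq> V \<and> mon_deg m = d}"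
  shows "finite (M d)" "card (M d) = (d + card V - 1) choose d"
proof -
  define vs where "vs = sorted_list_of_set V"
  have vs: "distinct vs" "set vs = V" "length vs = card V"
    using assms(1) by (auto simp: vs_def)
  define N where "N = {l :: nat list. length l = card V \<and> sum_list l = d}"
  have "bij_betw (\<lambda>m. map (Poly_Mapping.lookup m) vs) (M d) N"
  proof (rule bij_betwI')
    fix m m' assume m: "m \<in> M d" "m' \<in> M d"
    show "(map (Poly_Mapping.lookup m) vs = map (Poly_Mapping.lookup m') vs) = (m = m')"
    proof
      assume eq: "map (Poly_Mapping.lookup m) vs = map (Poly_Mapping.lookup m') vs"
      show "m = m'"
      proof (rule poly_mapping_eqI)
        fix i
        show "Poly_Mapping.lookup m i = Poly_Mapping.lookup m' i"
        proof (cases "i \<in> V")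
          case True
          with eq vs(2) show ?thesis by auto
        next
          case False
          then have "i \<notin> Poly_Mapping.keys m" "i \<notin> Poly_Mapping.keys m'"
            using m by (auto simp: M_def)
          then show ?thesis by (simp add: in_keys_iff)
        qed
      qed
    qed simp
  next
    fix m assume m: "m \<in> M d"
    have "sum_list (map (Poly_Mapping.lookup m) vs) = (\<Sum>i\<in>V. Poly_Mapping.lookup m i)"
      using sum.distinct_set_conv_list[OF vs(1)] vs(2) by metis
    then show "map (Poly_Mapping.lookup m) vs \<in> N"
      using m vs(3) mon_deg_superset[OF assms(1)] by (auto simp: N_def M_def)
  next
    fix l assume l: "l \<in> N"
    define m where "m = (\<Sum>j<length vs. Poly_Mapping.single (vs ! j) (l ! j))"
    have "Poly_Mapping.lookup m (vs ! k) = l ! k" if "k < length vs" for k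
    proof -
      have "Poly_Mapping.lookup m (vs ! k) = (\<Sum>j<length vs. if j = k then l ! k else 0)"
        unfolding m_def lookup_sum using that vs(1)
        by (intro sum.cong) (auto simp: lookup_single when_def nth_eq_iff_index_eq)
      then show ?thesis using that by simp
    qed
    then have lm: "l = map (Poly_Mapping.lookup m) vs"
      using l vs(3) by (intro nth_equalityI) (auto simp: N_def)
    have keys: "Poly_Mapping.keys m \<subseteq> V"
    proof
      fix i assume "i \<in> Poly_Mapping.keys m"
      then have "(\<Sum>j<length vs. Poly_Mapping.lookup (Poly_Mapping.single (vs ! j) (l ! j)) i) \<noteq> 0"
        by (simp add: in_keys_iff m_def lookup_sum)
      then obtain j where "j < length vs" "Poly_Mapping.lookup (Poly_Mapping.single (vs ! j) (l ! j)) i \<noteq> 0"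
        by (meson lessThan_iff sum.neutral)
      then show "i \<in> V" using vs(2) by (auto simp: lookup_single when_def split: if_splits)
    qed
    have "sum_list (map (Poly_Mapping.lookup m) vs) = (\<Sum>i\<in>V. Poly_Mapping.lookup m i)"
      using sum.distinct_set_conv_list[OF vs(1)] vs(2) by metis
    then have "mon_deg m = d"
      using l lm mon_deg_superset[OF assms(1) keys] by (simp add: N_def)
    with keys lm show "\<exists>m\<in>M d. l = map (Poly_Mapping.lookup m) vs"
      by (auto simp: M_def)
  qed
  moreover have "finite N"
  proof (rule finite_subset)
    show "N \<subseteq> {l. set l \<subseteq> {..d} \<and> length l = card V}"
      using member_le_sum_list by (fastforce simp: N_def)
  qed (simp add: finite_lists_length_eq)
  moreover have "card N = (d + card V - 1) choose d"
    unfolding N_def by (rule card_length_sum_list)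
  ultimately show "finite (M d)" "card (M d) = (d + card V - 1) choose d"
    by (simp_all add: bij_betw_finite bij_betw_same_card)
qed

lemma forms_basis:
  assumes "finite V"
  obtains B :: "'k::field mpol set" where "finite B" "card B = (d + card V - 1) choose d"
    "mpol.independent B" "B \<subseteq> forms V d" "forms V d \<subseteq> mpol.span B"
proof
  let ?M = "{m :: nat \<Rightarrow>\<^sub>0 nat. Poly_Mapping.keys m \<subseteq> V \<and> mon_deg m = d}"
  let ?mono = "\<lambda>m. Poly_Mapping.single m (1::'k)"
  have inj: "inj_on ?mono ?M"
    by (rule inj_onI) (metis lookup_single_eq lookup_single_not_eq zero_neq_one)
  show "finite (?mono ` ?M)" using card_monomials[OF assms] by blast
  show "card (?mono ` ?M) = (d + card V - 1) choose d"
    using card_image[OF inj] card_monomials[OF assms] by metis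
  show "?mono ` ?M \<subseteq> forms V d"
    by (auto simp: forms_def polys_def)
  show "mpol.independent (?mono ` ?M)"
  proof (rule mpol.independent_if_scalars_zero)
    show "finite (?mono ` ?M)" by fact
    fix f x assume f: "(\<Sum>x\<in>?mono ` ?M. cst (f x) * x) = 0" and x: "x \<in> ?mono ` ?M"
    then obtain m where m: "m \<in> ?M" "x = ?mono m" by blast
    have "0 = Poly_Mapping.lookup (\<Sum>k\<in>?M. cst (f (?mono k)) * ?mono k) m"
      using f by (simp add: sum.reindex[OF inj])
    also have "\<dots> = (\<Sum>k\<in>?M. if k = m then f x else 0)"
      unfolding lookup_sum using m
      by (intro sum.cong) (auto simp: lookup_cst_mult lookup_single when_def)
    also have "\<dots> = f x" using m card_monomials(1)[OF assms] by simp
    finally show "f x = 0" by simp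
  qed
  show "forms V d \<subseteq> mpol.span (?mono ` ?M)"
  proof
    fix p :: "'k mpol" assume p: "p \<in> forms V d"
    have "p = (\<Sum>m\<in>Poly_Mapping.keys p. cst (Poly_Mapping.lookup p m) * ?mono m)"
      by (subst poly_mapping_expand) (simp add: cst_def mult_single)
    moreover have "\<dots> \<in> mpol.span (?mono ` ?M)"
      using p by (intro mpol.span_sum mpol.span_scale mpol.span_base imageI) (auto simp: forms_def polys_def)
    ultimately show "p \<in> mpol.span (?mono ` ?M)" by (rule ssubst)
  qed
qed

text \<open>For n quadrics in n variables, the binomials are the dimensions of the forms of degree 2
  and 3, n^2 counts the products of a variable and a quadric, and n + 1 counts the quadrics together
  with one kernel element. Rearranged, the inequality says (n choose 2) - 1 < (n choose 3), which
  fails at n = 4 and holds from n = 5 on. The factor 6 in the proof clears denominators.\<close>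

lemma choose_2_less_choose_3:
  assumes "n \<ge> 5"
  shows "((2 + n - 1) choose 2) + n * n < ((3 + n - 1) choose 3) + (n + 1)"
proof -
  obtain m where m: "n = m + 5" using assms by (metis add.commute le_Suc_ex)
  define A D where "A = (n + 1) choose 2" and "D = (n + 2) choose 3"
  have a: "(n + 1) * n = A * 2"
    using Suc_times_binomial_eq[of n 1] by (simp add: A_def numeral_2_eq_2)
  have b: "(n + 2) * A = D * 3"
    using Suc_times_binomial_eq[of "n + 1" 2] by (simp add: A_def D_def numeral_3_eq_3)
  have "6 * (A + n * n) = 3 * (A * 2) + 6 * n * n"
    by simp
  also have "\<dots> = 3 * ((n + 1) * n) + 6 * n * n"
    by (simp only: a)
  also have "\<dots> < (n + 2) * ((n + 1) * n) + 6 * (n + 1)"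
    unfolding m by (simp add: algebra_simps)
  also have "\<dots> = (n + 2) * (A * 2) + 6 * (n + 1)"
    by (simp only: a)
  also have "\<dots> = 2 * ((n + 2) * A) + 6 * (n + 1)"
    by simp
  also have "\<dots> = 6 * (D + (n + 1))"
    by (simp only: b) simp
  finally show ?thesis by (simp add: A_def D_def numeral_3_eq_3)
qed

context quadrics
begin

text \<open>Multiplication by a variable turns it into a linear syzygy.\<close>

lemma constant_syzygy:
  assumes "V \<noteq> {}" "(\<Sum>i\<in>I. cst (c i) * q i) = 0" "i \<in> I"
  shows "c i = 0"
proof -
  obtain k where k: "k \<in> V" using assms(1) by blast
  have "(\<Sum>i\<in>I. (cst (c i) * var k) * q i) = var k * (\<Sum>i\<in>I. cst (c i) * q i)"
    by (simp add: sum_distrib_left algebra_simps)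
  then have "cst (c i) * var k = 0"
    using assms k
    by (intro linear_syzygy[where a = "\<lambda>i. cst (c i) * var k"] forms_cst_mult var_in_forms) auto
  then show ?thesis by (simp add: var_neq_0)
qed

text \<open>A kernel element \<open>f\<close> outside \<open>qspan\<close> extends the quadrics to
  \<open>card V + 1\<close> independent forms that \<open>x\<close> sends into the ideal. After
  completing them to a basis \<open>B\<close>, surjectivity shows that the cubic forms are spanned
  by the images of the remaining basis elements and the products \<open>var i * q j\<close>, which
  are too few. Only an upper bound for degree 3 of the ideal enters, so no Hilbert function has to
  be computed.\<close>

lemma surjective_imp_injective:
  assumes card: "card V \<ge> 5" "card I = card V" and x: "x \<in> forms V 1"
    and surj: "\<And>g. g \<in> forms V 3
      \<Longrightarrow> \<exists>h\<in>forms V 2. \<exists>a. (\<forall>i\<in>I. a i \<in> forms V 1) \<and> g = x * h + (\<Sum>i\<in>I. a i * q i)"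
    and f: "f \<in> forms V 2" "\<And>i. i \<in> I \<Longrightarrow> b i \<in> forms V 1" "x * f = (\<Sum>i\<in>I. b i * q i)"
  shows "f \<in> qspan"
proof (rule ccontr)
  assume f_notin: "f \<notin> qspan"
  let ?S = "insert f (q ` I)"
  have "V \<noteq> {}" using card by auto
  have q_qspan: "q i \<in> qspan" if "i \<in> I" for i
  proof -
    have "(\<Sum>j\<in>I. cst (if j = i then 1 else 0) * q j) = (\<Sum>j\<in>I. if j = i then q i else 0)"
      by (intro sum.cong) auto
    then show ?thesis using that finite_I by (auto simp: qspan_def intro!: exI[of _ "\<lambda>j. if j = i then 1 else 0"])
  qed
  have inj: "inj_on q I"
  proof (rule inj_onI, rule ccontr)
    fix i j assume ij: "i \<in> I" "j \<in> I" "q i = q j" "i \<noteq> j"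
    let ?c = "\<lambda>k. if k = i then 1 else if k = j then - 1 else 0 :: 'k"
    have "(\<Sum>k\<in>I. cst (?c k) * q k) = (\<Sum>k\<in>{i, j}. cst (?c k) * q k)"
      using ij finite_I by (intro sum.mono_neutral_right) auto
    also have "\<dots> = 0" using ij by (simp add: cst_uminus)
    finally have "?c i = 0" using constant_syzygy[OF \<open>V \<noteq> {}\<close>, of ?c i] ij by blast
    then show False by simp
  qed
  have "mpol.independent (q ` I)"
  proof (rule mpol.independent_if_scalars_zero)
    fix c y assume c: "(\<Sum>y\<in>q ` I. cst (c y) * y) = 0" "y \<in> q ` I"
    then obtain i where "i \<in> I" "y = q i" by blast
    moreover have "(\<Sum>i\<in>I. cst (c (q i)) * q i) = 0" using c(1) by (simp add: sum.reindex[OF inj])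
    ultimately show "c y = 0"
      using constant_syzygy[OF \<open>V \<noteq> {}\<close>, of "\<lambda>i. c (q i)"] by simp
  qed (simp add: finite_I)
  moreover have "mpol.span (q ` I) \<subseteq> qspan"
    using q_qspan by (intro mpol.span_minimal subspace_qspan) auto
  ultimately have indep: "mpol.independent ?S"
    using f_notin by (intro mpol.independent_insertI) auto
  have card_S: "card ?S = card V + 1"
    using f_notin q_qspan finite_I card_image[OF inj] card(2) by (subst card_insert_disjoint) auto
  obtain M2 :: "'k mpol set" where M2: "finite M2" "card M2 = (2 + card V - 1) choose 2" "forms V 2 \<subseteq> mpol.span M2"
    using forms_basis[OF finite_V] by metis
  obtain M3 :: "'k mpol set" where M3: "card M3 = (3 + card V - 1) choose 3"
    "mpol.independent M3" "M3 \<subseteq> forms V 3"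
    using forms_basis[OF finite_V] by metis
  have "?S \<subseteq> forms V 2" using f q_in_forms by auto
  then obtain B where B: "?S \<subseteq> B" "B \<subseteq> forms V 2" "mpol.independent B" "forms V 2 \<subseteq> mpol.span B"
    using indep mpol.maximal_independent_subset_extend by metis
  have cB: "finite B" "card B \<le> card M2"
    using mpol.independent_span_bound[OF M2(1) B(3)] B(2) M2(3) by auto
  define T where "T = (\<lambda>e. x * e) ` (B - ?S) \<union> (\<lambda>(i, j). var i * q j) ` (V \<times> I)"
  have "finite T" using cB(1) finite_V finite_I by (simp add: T_def)
  have lin: "(\<Sum>j\<in>I. a j * q j) \<in> mpol.span T" if a: "\<And>j. j \<in> I \<Longrightarrow> a j \<in> forms V 1" for a
  proof (rule mpol.span_sum)
    fix j assume j: "j \<in> I"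
    let ?s = "\<Sum>i\<in>V. cst (Poly_Mapping.lookup (a j) (Poly_Mapping.single i 1)) * var i"
    have "a j = ?s" using form_1_expand[OF finite_V a[OF j]] .
    then have "a j * q j = ?s * q j" by (rule arg_cong)
    moreover have "?s * q j \<in> mpol.span T"
      unfolding sum_distrib_right mult.assoc using j
      by (intro mpol.span_sum mpol.span_scale mpol.span_base) (auto simp: T_def)
    ultimately show "a j * q j \<in> mpol.span T" by (rule ssubst)
  qed
  have sub: "mpol.subspace {h. x * h \<in> mpol.span T}"
    by (rule mpol.subspaceI)
      (auto simp: distrib_left mult.left_commute[of x] mpol.span_zero mpol.span_add mpol.span_scale)
  have "x * e \<in> mpol.span T" if "e \<in> B" for e
  proof -
    consider "e = f" | i where "i \<in> I" "e = q i" | "e \<in> B - ?S" using \<open>e \<in> B\<close> by blast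
    then show ?thesis
    proof cases
      case 1
      then show ?thesis using lin f by simp
    next
      case 2
      have "(\<Sum>j\<in>I. (if j = i then x else 0) * q j) = (\<Sum>j\<in>I. if j = i then x * q i else 0)"
        by (intro sum.cong) auto
      also have "\<dots> = x * e" using 2 finite_I by simp
      finally show ?thesis using lin[of "\<lambda>j. if j = i then x else 0"] x by simp
    next
      case 3
      then have "x * e \<in> T" unfolding T_def by (intro UnI1 imageI)
      then show ?thesis by (rule mpol.span_base)
    qed
  qed
  then have "mpol.span B \<subseteq> {h. x * h \<in> mpol.span T}"
    by (intro mpol.span_minimal sub) auto
  then have "x * h \<in> mpol.span T" if "h \<in> forms V 2" for h
    using B(4) that by blast
  note x_mult = this
  have "forms V 3 \<subseteq> mpol.span T"
  proof
    fix g :: "'k mpol" assume "g \<in> forms V 3"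
    then obtain h a where "h \<in> forms V 2" "\<forall>i\<in>I. a i \<in> forms V 1" "g = x * h + (\<Sum>i\<in>I. a i * q i)"
      using surj by blast
    then show "g \<in> mpol.span T" using x_mult lin by (simp add: mpol.span_add)
  qed
  then have "card M3 \<le> card T"
    using mpol.independent_span_bound[OF \<open>finite T\<close> M3(2)] M3(3) by blast
  also have "\<dots> \<le> card (B - ?S) + card (V \<times> I)"
    unfolding T_def using cB(1) finite_V finite_I
    by (intro order.trans[OF card_Un_le] add_mono card_image_le) auto
  also have "\<dots> = card B - (card V + 1) + card V * card V"
    using card_Diff_subset[of ?S B] finite_I B(1) card_S card(2) by (simp add: card_cartesian_product)
  finally have "card M3 + (card V + 1) \<le> card M2 + card V * card V"
    using cB card_S card_mono[OF cB(1) B(1)] by linarith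
  with choose_2_less_choose_3[OF card(1)] M2(2) M3(1) show False by linarith
qed

end

section \<open>Ideals generated by quadrics\<close>

text \<open>Arbitrary sets of variables and of indices, unlike in \<open>ideal_gen\<close>, make it
  possible to drop one generator and to eliminate one variable without renumbering.\<close>

definition gen :: "nat set \<Rightarrow> nat set \<Rightarrow> (nat \<Rightarrow> 'k::comm_ring_1 mpol) \<Rightarrow> 'k mpol set" where
  "gen V I q = {p. \<exists>a. (\<forall>i\<in>I. a i \<in> polys V) \<and> p = (\<Sum>i\<in>I. a i * q i)}"

lemma ideal_gen_eq_gen: "ideal_gen n gs = gen {..n} {..<length gs} (\<lambda>i. gs ! i)"
  by (auto simp: ideal_gen_def gen_def in_S_iff_polys)

lemma genI: "(\<And>i. i \<in> I \<Longrightarrow> a i \<in> polys V) \<Longrightarrow> (\<Sum>i\<in>I. a i * q i) \<in> gen V I q"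
  by (auto simp: gen_def)

lemma genE:
  assumes "p \<in> gen V I q"
  obtains a where "\<And>i. i \<in> I \<Longrightarrow> a i \<in> polys V" "p = (\<Sum>i\<in>I. a i * q i)"
  using assms by (auto simp: gen_def)

lemma gen_0: "0 \<in> gen V I q"
  using genI[of I "\<lambda>_. 0" V q] by simp

lemma gen_add: "f \<in> gen V I q \<Longrightarrow> g \<in> gen V I q \<Longrightarrow> f + g \<in> gen V I q"
proof (elim genE)
  fix a b assume "\<And>i. i \<in> I \<Longrightarrow> a i \<in> polys V" "f = (\<Sum>i\<in>I. a i * q i)"
    "\<And>i. i \<in> I \<Longrightarrow> b i \<in> polys V" "g = (\<Sum>i\<in>I. b i * q i)"
  then show ?thesis
    using genI[of I "\<lambda>i. a i + b i" V q] by (simp add: polys_add distrib_right sum.distrib)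
qed

lemma gen_mult: "h \<in> polys V \<Longrightarrow> f \<in> gen V I q \<Longrightarrow> h * f \<in> gen V I q"
proof (elim genE)
  fix a assume "h \<in> polys V" "\<And>i. i \<in> I \<Longrightarrow> a i \<in> polys V" "f = (\<Sum>i\<in>I. a i * q i)"
  then show ?thesis
    using genI[of I "\<lambda>i. h * a i" V q] by (simp add: polys_mult sum_distrib_left mult.assoc)
qed

lemma gen_diff: "f \<in> gen V I q \<Longrightarrow> g \<in> gen V I q \<Longrightarrow> f - g \<in> gen V I q"
  using gen_add[of f V I q "cst (- 1) * g"] gen_mult[OF cst_in_polys, of g V I q "- 1"]
  by (simp add: cst_uminus)

lemma gen_mono: "finite I \<Longrightarrow> J \<subseteq> I \<Longrightarrow> gen V J q \<subseteq> gen V I q"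
proof
  fix f assume J: "finite I" "J \<subseteq> I" "f \<in> gen V J q"
  obtain a where "\<And>i. i \<in> J \<Longrightarrow> a i \<in> polys V" "f = (\<Sum>i\<in>J. a i * q i)"
    using genE[OF J(3)] by blast
  moreover have "(\<Sum>i\<in>J. a i * q i) = (\<Sum>i\<in>I. (if i \<in> J then a i else 0) * q i)"
    using J by (intro sum.mono_neutral_cong_left) auto
  ultimately show "f \<in> gen V I q"
    using genI[of I "\<lambda>i. if i \<in> J then a i else 0" V q] by simp
qed

lemma subspace_gen: "mpol.subspace (gen V I q)"
  by (auto intro!: mpol.subspaceI gen_0 gen_add gen_mult)

text \<open>The last clause is separate because \<open>d - 2\<close> is truncated: below degree 2
  the representation alone would allow constant coefficients.\<close>

lemma component_in_gen:
  assumes q: "\<And>i. i \<in> I \<Longrightarrow> q i \<in> forms V 2" and f: "f \<in> gen V I q"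
  obtains a where "\<And>i. i \<in> I \<Longrightarrow> a i \<in> forms V (d - 2)" "component d f = (\<Sum>i\<in>I. a i * q i)"
    "d < 2 \<Longrightarrow> component d f = 0"
proof -
  obtain a where a: "\<And>i. i \<in> I \<Longrightarrow> a i \<in> polys V" "f = (\<Sum>i\<in>I. a i * q i)"
    using genE[OF f] by blast
  have *: "component d f = (\<Sum>i\<in>I. if 2 \<le> d then component (d - 2) (a i) * q i else 0)"
    unfolding a(2) component_sum by (intro sum.cong refl component_mult[where V = V] q)
  show thesis
  proof (rule that)
    show "(if 2 \<le> d then component (d - 2) (a i) else 0) \<in> forms V (d - 2)" if "i \<in> I" for i
      using a(1)[OF that] by (simp add: component_in_forms)
    show "component d f = (\<Sum>i\<in>I. (if 2 \<le> d then component (d - 2) (a i) else 0) * q i)"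
      unfolding * by (intro sum.cong refl) simp
    show "component d f = 0" if "d < 2"
      unfolding * using that by (intro sum.neutral) simp
  qed
qed

lemma form_in_gen:
  assumes "\<And>i. i \<in> I \<Longrightarrow> q i \<in> forms V 2" and "f \<in> gen V I q" "f \<in> forms V d"
  obtains a where "\<And>i. i \<in> I \<Longrightarrow> a i \<in> forms V (d - 2)" "f = (\<Sum>i\<in>I. a i * q i)" "d < 2 \<Longrightarrow> f = 0"
proof -
  have f: "component d f = f" using component_form[OF assms(3), of d] by simp
  show thesis using component_in_gen[OF assms(1,2), of d] that unfolding f by blast
qed

lemma (in quadrics) qspan_iff_gen:
  assumes "f \<in> forms V 2"
  shows "f \<in> qspan \<longleftrightarrow> f \<in> gen V I q"
proof
  assume "f \<in> qspan"
  then show "f \<in> gen V I q" by (auto simp: qspan_def intro!: genI)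
next
  assume "f \<in> gen V I q"
  from form_in_gen[OF q_in_forms this assms]
  obtain a where a: "\<And>i. i \<in> I \<Longrightarrow> a i \<in> forms V 0" "f = (\<Sum>i\<in>I. a i * q i)" by auto
  define c where "c i = Poly_Mapping.lookup (a i) 0" for i
  have "a i = cst (c i)" if "i \<in> I" for i
    using a(1)[OF that] form_0_is_cst by (metis c_def cst_def lookup_single_eq)
  then have "f = (\<Sum>i\<in>I. cst (c i) * q i)" using a(2) by simp
  then show "f \<in> qspan" by (auto simp: qspan_def)
qed

section \<open>Koszul syzygies of regular sequences\<close>

text \<open>The matrix \<open>b\<close> is alternating; it records \<open>a\<close> as a combination
  of the trivial relations q_l q_i - q_i q_l = 0.\<close>

definition koszul_syzygy ::
  "nat set \<Rightarrow> nat set \<Rightarrow> (nat \<Rightarrow> 'k::comm_ring_1 mpol) \<Rightarrow> (nat \<Rightarrow> 'k mpol) \<Rightarrow> (nat \<Rightarrow> nat \<Rightarrow> 'k mpol) \<Rightarrow> bool"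
  where "koszul_syzygy V I q a b \<longleftrightarrow> (\<forall>i\<in>I. \<forall>l\<in>I. b i l \<in> polys V \<and> b i l + b l i = 0)
    \<and> (\<forall>i\<in>I. b i i = 0) \<and> (\<forall>i\<in>I. a i = (\<Sum>l\<in>I. b i l * q l))"

text \<open>Vanishing of the first Koszul homology, a condition symmetric in the generators.\<close>

definition koszul_syzygies :: "nat set \<Rightarrow> nat set \<Rightarrow> (nat \<Rightarrow> 'k::comm_ring_1 mpol) \<Rightarrow> bool" where
  "koszul_syzygies V I q \<longleftrightarrow> (\<forall>a. (\<forall>i\<in>I. a i \<in> polys V) \<longrightarrow> (\<Sum>i\<in>I. a i * q i) = 0 \<longrightarrow>
     (\<exists>b. koszul_syzygy V I q a b))"

lemma koszul_syzygiesE: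
  assumes "koszul_syzygies V I q" "\<forall>i\<in>I. a i \<in> polys V" "(\<Sum>i\<in>I. a i * q i) = 0"
  obtains b where "koszul_syzygy V I q a b"
  using assms by (auto simp: koszul_syzygies_def)

text \<open>Regularity puts the last coefficient into the ideal of the earlier generators, say a_r =
  sum of c_i q_i. Subtracting the trivial relations between q_r and q_i with weights c_i removes
  this coefficient and leaves a syzygy of the first \<open>r\<close> generators.\<close>

lemma regular_seq_koszul_syzygies:
  assumes reg: "regular_seq n qs" and q: "\<And>i. i < length qs \<Longrightarrow> qs ! i \<in> polys {..n}"
    and "r \<le> length qs"
  shows "koszul_syzygies {..n} {..<r} (\<lambda>i. qs ! i)"
  using \<open>r \<le> length qs\<close>
proof (induction r)
  case 0
  show ?case by (simp add: koszul_syzygies_def koszul_syzygy_def)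
next
  case (Suc r)
  show ?case unfolding koszul_syzygies_def
  proof (intro allI impI)
    fix a assume a: "\<forall>i\<in>{..<Suc r}. a i \<in> polys {..n}" "(\<Sum>i<Suc r. a i * qs ! i) = 0"
    have gen: "ideal_gen n (take r qs) = gen {..n} {..<r} (\<lambda>i. qs ! i)"
      using Suc.prems by (auto simp: ideal_gen_eq_gen gen_def)
    have "a r * qs ! r = (\<Sum>i<r. (- a i) * qs ! i)"
      using a by (simp add: sum_negf eq_neg_iff_add_eq_0 add.commute)
    moreover have "(\<Sum>i<r. (- a i) * qs ! i) \<in> gen {..n} {..<r} (\<lambda>i. qs ! i)"
      using a by (intro genI polys_uminus) auto
    ultimately have "a r \<in> gen {..n} {..<r} (\<lambda>i. qs ! i)"
      using reg a Suc.prems unfolding regular_seq_def gen[symmetric] in_S_iff_polys by auto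
    then obtain c where c: "\<And>i. i < r \<Longrightarrow> c i \<in> polys {..n}" "a r = (\<Sum>i<r. c i * qs ! i)"
      by (elim genE) auto
    have "(\<Sum>i<r. (a i + c i * qs ! r) * qs ! i) = (\<Sum>i<Suc r. a i * qs ! i)"
      by (simp add: c(2) sum.distrib sum_distrib_left algebra_simps)
    also have "\<dots> = 0" using a by simp
    finally have zero: "(\<Sum>i<r. (a i + c i * qs ! r) * qs ! i) = 0" .
    have pol: "\<forall>i\<in>{..<r}. a i + c i * qs ! r \<in> polys {..n}"
      using a c(1) q Suc.prems by (auto intro!: polys_add polys_mult)
    have kos: "koszul_syzygies {..n} {..<r} (\<lambda>i. qs ! i)" using Suc by simp
    obtain b where "koszul_syzygy {..n} {..<r} (\<lambda>i. qs ! i) (\<lambda>i. a i + c i * qs ! r) b"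
      using koszul_syzygiesE[OF kos pol zero] .
    then have b: "\<forall>i\<in>{..<r}. \<forall>l\<in>{..<r}. b i l \<in> polys {..n} \<and> b i l + b l i = 0"
      "\<forall>i\<in>{..<r}. b i i = 0" "\<forall>i\<in>{..<r}. a i + c i * qs ! r = (\<Sum>l<r. b i l * qs ! l)"
      by (simp_all add: koszul_syzygy_def)
    \<comment> \<open>\<open>b\<close> bordered by the relations involving generator
      \<open>r\<close>: last column \<open>- c i\<close>, last row \<open>c l\<close>, corner
      0.\<close>
    define b' where "b' i l = (if i < r then if l < r then b i l else - c i else if l < r then c l else 0)" for i l
    have "b' i l \<in> polys {..n} \<and> b' i l + b' l i = 0" if "i < Suc r" "l < Suc r" for i l
      using b(1) c(1) that by (auto simp: b'_def polys_uminus)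
    moreover have "b' i i = 0" if "i < Suc r" for i
      using b(2) by (auto simp: b'_def)
    moreover have "a i = (\<Sum>l<Suc r. b' i l * qs ! l)" if "i < Suc r" for i
    proof (cases "i < r")
      case True
      then have "a i = (\<Sum>l<r. b i l * qs ! l) - c i * qs ! r" using b(3) by (simp add: eq_diff_eq)
      then show ?thesis using True by (simp add: b'_def)
    next
      case False
      then have "i = r" using that by simp
      then show ?thesis using c(2) by (simp add: b'_def)
    qed
    ultimately show "\<exists>b. koszul_syzygy {..n} {..<Suc r} (\<lambda>i. qs ! i) a b"
      unfolding koszul_syzygy_def by (intro exI[of _ b']) auto
  qed
qed

text \<open>The membership is a syzygy whose entry at \<open>j\<close> is \<open>f\<close>. Row
  \<open>j\<close> of the alternating matrix writes \<open>f\<close> through the generators, and its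
  diagonal entry vanishes, so \<open>q j\<close> does not occur.\<close>

lemma generator_regular_mod_others:
  assumes kos: "koszul_syzygies V I q" and I: "finite I" "j \<in> I"
    and f: "f \<in> polys V" "f * q j \<in> gen V (I - {j}) q"
  shows "f \<in> gen V (I - {j}) q"
proof -
  obtain a where a: "\<And>i. i \<in> I - {j} \<Longrightarrow> a i \<in> polys V" "f * q j = (\<Sum>i\<in>I-{j}. a i * q i)"
    using genE[OF f(2)] by blast
  let ?a = "\<lambda>i. if i = j then f else - a i"
  have "(\<Sum>i\<in>I. ?a i * q i) = f * q j + (\<Sum>i\<in>I-{j}. ?a i * q i)"
    using I by (subst sum.remove[of _ j]) auto
  also have "\<dots> = 0" unfolding a(2) sum.distrib[symmetric] by (intro sum.neutral) auto
  finally have zero: "(\<Sum>i\<in>I. ?a i * q i) = 0" .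
  have pol: "\<forall>i\<in>I. ?a i \<in> polys V"
    using a(1) f(1) by (auto intro: polys_uminus)
  obtain b where "koszul_syzygy V I q ?a b"
    using koszul_syzygiesE[OF kos pol zero] .
  then have b: "\<forall>i\<in>I. \<forall>l\<in>I. b i l \<in> polys V \<and> b i l + b l i = 0"
    "\<forall>i\<in>I. b i i = 0" "\<forall>i\<in>I. ?a i = (\<Sum>l\<in>I. b i l * q l)"
    by (simp_all add: koszul_syzygy_def)
  have "f = (\<Sum>l\<in>I. b j l * q l)" using bspec[OF b(3) I(2)] by simp
  also have "\<dots> = (\<Sum>l\<in>I-{j}. b j l * q l)"
    using I b(2) by (subst sum.remove[of _ j]) auto
  finally show ?thesis using b(1) I genI[of "I - {j}" "b j" V q] by auto
qed

text \<open>By degree, linear entries in the ideal vanish, and for quadratic entries only the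
  constant terms of the matrix \<open>b\<close> matter. A syzygy of a subfamily is extended by zero
  to all of \<open>I\<close>.\<close>

lemma quadrics_of_koszul_syzygies:
  fixes q :: "nat \<Rightarrow> 'k::field mpol"
  assumes kos: "koszul_syzygies V I q" and fin: "finite V" "finite I"
    and q: "\<And>i. i \<in> I \<Longrightarrow> q i \<in> forms V 2" and V: "V \<noteq> {}" and J: "J \<subseteq> I"
  shows "quadrics V J q"
proof -
  have syz1: "a i = 0" if a: "\<And>i. i \<in> I \<Longrightarrow> a i \<in> forms V 1" "(\<Sum>i\<in>I. a i * q i) = 0" "i \<in> I"
    for a :: "nat \<Rightarrow> 'k mpol" and i
  proof -
    have pol: "\<forall>i\<in>I. a i \<in> polys V" using a(1) forms_subset_polys by blast
    obtain b where "koszul_syzygy V I q a b"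
      using koszul_syzygiesE[OF kos pol a(2)] .
    then have b: "\<forall>i\<in>I. \<forall>l\<in>I. b i l \<in> polys V \<and> b i l + b l i = 0"
      "\<forall>i\<in>I. b i i = 0" "\<forall>i\<in>I. a i = (\<Sum>l\<in>I. b i l * q l)"
      by (simp_all add: koszul_syzygy_def)
    have "(\<Sum>l\<in>I. b i l * q l) \<in> gen V I q" using b(1) a(3) by (intro genI) blast
    then have "a i \<in> gen V I q" using bspec[OF b(3) a(3)] by (simp only:)
    from form_in_gen[OF q this a(1)[OF a(3)]] show ?thesis by auto
  qed
  have syz0: "c i = 0" if c: "(\<Sum>i\<in>I. cst (c i) * q i) = 0" "i \<in> I" for c i
  proof -
    obtain k where k: "k \<in> V" using V by blast
    have "(\<Sum>i\<in>I. (cst (c i) * var k) * q i) = var k * (\<Sum>i\<in>I. cst (c i) * q i)"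
      by (simp add: sum_distrib_left algebra_simps)
    then have "cst (c i) * var k = 0"
      using c k by (intro syz1[where a = "\<lambda>i. cst (c i) * var k"] forms_cst_mult var_in_forms) auto
    then show ?thesis by (simp add: var_neq_0)
  qed
  have ext: "(\<Sum>i\<in>J. a i * q i) = (\<Sum>i\<in>I. (if i \<in> J then a i else 0) * q i)" for a
    using J fin by (intro sum.mono_neutral_cong_left) auto
  show ?thesis
  proof
    show "finite V" "finite J" using fin J finite_subset by blast+
    show "q i \<in> forms V 2" if "i \<in> J" for i using that J q by blast
    fix a :: "nat \<Rightarrow> 'k mpol" and i
    let ?a = "\<lambda>i. if i \<in> J then a i else 0"
    show "a i = 0" if "\<And>i. i \<in> J \<Longrightarrow> a i \<in> forms V 1" "(\<Sum>i\<in>J. a i * q i) = 0" "i \<in> J"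
      using syz1[of ?a i] that J ext by (auto split: if_splits)
    assume a: "\<And>i. i \<in> J \<Longrightarrow> a i \<in> forms V 2" "(\<Sum>i\<in>J. a i * q i) = 0" "i \<in> J"
    have a': "?a i \<in> forms V 2" for i using a(1) by simp
    have pol: "\<forall>i\<in>I. ?a i \<in> polys V" using a' forms_subset_polys by blast
    have zero: "(\<Sum>i\<in>I. ?a i * q i) = 0" using a(2) ext by simp
  obtain b where "koszul_syzygy V I q ?a b"
    using koszul_syzygiesE[OF kos pol zero] .
  then have b: "\<forall>i\<in>I. \<forall>l\<in>I. b i l \<in> polys V \<and> b i l + b l i = 0"
    "\<forall>i\<in>I. b i i = 0" "\<forall>i\<in>I. ?a i = (\<Sum>l\<in>I. b i l * q l)"
    by (simp_all add: koszul_syzygy_def)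
    define c where "c i l = Poly_Mapping.lookup (b i l) 0" for i l
    have eq: "?a i = (\<Sum>l\<in>I. cst (c i l) * q l)" if i: "i \<in> I" for i
    proof -
      have "?a i = component 2 (\<Sum>l\<in>I. b i l * q l)"
        using component_form[OF a', of 2 i] bspec[OF b(3) i] by simp
      also have "\<dots> = (\<Sum>l\<in>I. component 0 (b i l) * q l)"
        unfolding component_sum by (intro sum.cong refl) (simp add: component_mult[OF q])
      also have "\<dots> = (\<Sum>l\<in>I. cst (c i l) * q l)"
      proof (intro sum.cong refl)
        fix l
        have "component 0 (b i l) = cst (c i l)"
          by (intro poly_mapping_eqI)
            (auto simp: lookup_component c_def cst_def lookup_single when_def mon_deg_eq_0_iff)
        then show "component 0 (b i l) * q l = cst (c i l) * q l" by simp
      qed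
      finally show ?thesis .
    qed
    \<comment> \<open>Row \<open>l\<close> of the extended syzygy is zero, so its constant
      coefficients vanish by \<open>syz0\<close>; antisymmetry carries this from row
      \<open>l\<close> to column \<open>l\<close>. Hence generators outside \<open>J\<close> drop
      out.\<close>
    have "c i l = 0" if "l \<in> I - J" for l
    proof -
      have "(\<Sum>k\<in>I. cst (c l k) * q k) = 0" using eq[of l] that by simp
      then have "c l i = 0" using syz0 a(3) J by blast
      have "b i l + b l i = 0" using b(1) that a(3) J by blast
      then have "b i l = - b l i" by (simp add: eq_neg_iff_add_eq_0)
      with \<open>c l i = 0\<close> show ?thesis by (simp add: c_def)
    qed
    then have "(\<Sum>l\<in>I. cst (c i l) * q l) = (\<Sum>l\<in>J. cst (c i l) * q l)"
      using J fin by (intro sum.mono_neutral_right) auto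
    then show "\<exists>c. a i = (\<Sum>l\<in>J. cst (c l) * q l)"
      using eq[of i] a(3) J by auto
  qed
qed

section \<open>Elimination of a variable by a linear form\<close>

text \<open>The nonzero coefficient of \<open>var k\<close> allows solving for it modulo
  \<open>v\<close>. The quotient by \<open>v\<close> is thereby realised as a polynomial ring again,
  so that the locale \<open>quadrics\<close> can be applied to it.\<close>

locale elimination =
  fixes S V :: "nat set" and k :: nat and v :: "'k::field mpol"
  assumes finite_S: "finite S" and k_in_S: "k \<in> S" and V_eq: "V = S - {k}"
    and v_form: "v \<in> forms S 1" and v_k: "Poly_Mapping.lookup v (Poly_Mapping.single k 1) \<noteq> 0"
begin

lemma V_subset: "V \<subseteq> S"
  using V_eq by blast

lemma polys_V_S: "p \<in> polys V \<Longrightarrow> p \<in> polys S"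
  using polys_mono[OF V_subset] by blast

lemma v_polys: "v \<in> polys S"
  using v_form forms_subset_polys by blast

lemma v_split:
  obtains r v' where "r \<noteq> 0" "v' \<in> polys V" "v = cst r * var k + v'"
proof
  define r where "r = Poly_Mapping.lookup v (Poly_Mapping.single k 1)"
  show "r \<noteq> 0" using v_k by (simp add: r_def)
  have v': "v - cst r * var k \<in> forms S 1"
    by (intro forms_diff v_form forms_cst_mult var_in_forms k_in_S)
  have "Poly_Mapping.lookup (v - cst r * var k) (Poly_Mapping.single k 1) = 0"
    by (simp add: lookup_minus lookup_cst_mult r_def)
  then have "Poly_Mapping.keys m \<subseteq> V" if m: "m \<in> Poly_Mapping.keys (v - cst r * var k)" for m
  proof -
    have "mon_deg m = 1" "Poly_Mapping.keys m \<subseteq> S" using m v' by (auto simp: forms_def polys_def)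
    then obtain i where "i \<in> S" "m = Poly_Mapping.single i 1" by (metis mon_deg_1 subsetD)
    moreover have "i \<noteq> k"
      using m \<open>Poly_Mapping.lookup (v - cst r * var k) _ = 0\<close> \<open>m = _\<close> by (auto simp: in_keys_iff)
    ultimately show ?thesis by (simp add: V_eq)
  qed
  then show "v - cst r * var k \<in> polys V" by (auto simp: polys_def)
  show "v = cst r * var k + (v - cst r * var k)" by simp
qed

text \<open>A term of \<open>u\<close> with the highest power of \<open>var k\<close> is raised by
  the \<open>var k\<close> in \<open>v\<close>, and nothing can cancel the result, as
  \<open>v'\<close> is free of that variable. This gives uniqueness of normal forms modulo
  \<open>v\<close>.\<close>

lemma multiple_without_var_eq_0:
  assumes "v * u \<in> polys V"
  shows "u = 0"
proof (rule ccontr)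
  assume "u \<noteq> 0"
  then obtain m0 where "m0 \<in> Poly_Mapping.keys u"
    by (metis ex_in_conv keys_eq_empty)
  define e where "e = Max ((\<lambda>m. Poly_Mapping.lookup m k) ` Poly_Mapping.keys u)"
  have "e \<in> (\<lambda>m. Poly_Mapping.lookup m k) ` Poly_Mapping.keys u"
    unfolding e_def using \<open>m0 \<in> _\<close> by (intro Max_in) auto
  then obtain m where m: "m \<in> Poly_Mapping.keys u" "Poly_Mapping.lookup m k = e" by auto
  have max: "Poly_Mapping.lookup b k \<le> e" if "b \<in> Poly_Mapping.keys u" for b
    unfolding e_def using that by (intro Max_ge) auto
  obtain r v' where v: "r \<noteq> 0" "v' \<in> polys V" "v = cst r * var k + v'" by (rule v_split)
  let ?m = "Poly_Mapping.single k 1 + m"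
  have "?m \<notin> Poly_Mapping.keys (v' * u)"
  proof
    assume "?m \<in> Poly_Mapping.keys (v' * u)"
    then obtain a b where ab: "?m = a + b" "a \<in> Poly_Mapping.keys v'" "b \<in> Poly_Mapping.keys u"
      using keys_mult[of v' u] by blast
    then have "k \<notin> Poly_Mapping.keys a" using v(2) by (auto simp: polys_def V_eq)
    then have "Poly_Mapping.lookup b k = 1 + e"
      using arg_cong[OF ab(1), of "\<lambda>m. Poly_Mapping.lookup m k"] m(2) by (simp add: lookup_add in_keys_iff)
    with max[OF ab(3)] show False by simp
  qed
  then have "Poly_Mapping.lookup (v * u) ?m = r * Poly_Mapping.lookup u m"
    unfolding v(3) distrib_right mult.assoc
    by (simp only: lookup_add lookup_cst_mult lookup_var_mult in_keys_iff) simp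
  then have "?m \<in> Poly_Mapping.keys (v * u)" using v(1) m(1) by (simp add: in_keys_iff)
  then have "k \<in> V" using assms by (auto simp: polys_def keys_add_nat)
  then show False by (simp add: V_eq)
qed

text \<open>The decomposable polynomials \<open>D\<close> are closed under sums and under
  multiplication by each variable, the case of \<open>var k\<close> being the solution of
  \<open>v\<close> for it. Monomials follow by induction on the degree.\<close>

lemma decomposition:
  assumes "p \<in> polys S"
  shows "\<exists>p0\<in>polys V. \<exists>u\<in>polys S. p = p0 + v * u"
proof -
  define D where "D = {p. \<exists>p0\<in>polys V. \<exists>u\<in>polys S. p = p0 + v * u}"
  have D_add: "p + p' \<in> D" if "p \<in> D" "p' \<in> D" for p p'
  proof -
    obtain p0 u p0' u' where "p0 \<in> polys V" "u \<in> polys S" "p = p0 + v * u"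
      "p0' \<in> polys V" "u' \<in> polys S" "p' = p0' + v * u'"
      using \<open>p \<in> D\<close> \<open>p' \<in> D\<close> unfolding D_def by blast
    then show ?thesis unfolding D_def
      by (intro CollectI bexI[of _ "p0 + p0'"] bexI[of _ "u + u'"]) (auto simp: algebra_simps intro: polys_add)
  qed
  have D_mult: "v * h \<in> D" if "h \<in> polys S" for h
    unfolding D_def using that by (intro CollectI bexI[of _ 0] bexI[of _ h]) auto
  have D_V: "h \<in> D" if "h \<in> polys V" for h
    unfolding D_def using that by (intro CollectI bexI[of _ h] bexI[of _ 0]) auto
  obtain r v' where v: "r \<noteq> 0" "v' \<in> polys V" "v = cst r * var k + v'" by (rule v_split)
  have "cst (inverse r) * v = cst (inverse r) * (cst r * var k) + cst (inverse r) * v'"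
    unfolding v(3) by (rule distrib_left)
  then have var_k: "var k = v * cst (inverse r) + cst (- inverse r) * v'"
    using v(1) by (simp add: mult.assoc[symmetric] cst_mult[symmetric] cst_uminus mult.commute)
  have D_var: "var i * p \<in> D" if "p \<in> D" "i \<in> S" for i p
  proof -
    obtain p0 u where p: "p0 \<in> polys V" "u \<in> polys S" "p = p0 + v * u"
      using \<open>p \<in> D\<close> unfolding D_def by blast
    have var: "(var i :: 'k mpol) \<in> polys S" using that(2) var_in_forms forms_subset_polys by blast
    have "var i * p0 \<in> D"
    proof (cases "i = k")
      case True
      have "var i * p0 = v * (cst (inverse r) * p0) + cst (- inverse r) * v' * p0"
        unfolding True by (subst var_k) (simp add: algebra_simps)
      moreover have "cst (- inverse r) * v' * p0 \<in> polys V"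
        by (intro polys_mult cst_in_polys v p)
      moreover have "cst (inverse r) * p0 \<in> polys S"
        by (intro polys_mult cst_in_polys polys_V_S p)
      ultimately show ?thesis by (simp only: D_add D_mult D_V)
    next
      case False
      then have "(var i :: 'k mpol) \<in> polys V"
        using that(2) by (intro subsetD[OF forms_subset_polys var_in_forms]) (simp add: V_eq)
      then show ?thesis by (intro D_V polys_mult p)
    qed
    moreover have "var i * p = var i * p0 + v * (var i * u)"
      unfolding p(3) by (simp add: algebra_simps)
    moreover have "var i * u \<in> polys S" by (intro polys_mult var p)
    ultimately show ?thesis by (simp only: D_add D_mult)
  qed
  have "Poly_Mapping.single m c \<in> D" if "Poly_Mapping.keys m \<subseteq> S" for m c
    using that
  proof (induction "mon_deg m" arbitrary: m)
    case 0
    then have "m = 0" by (simp add: mon_deg_eq_0_iff)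
    then show ?case using D_V[OF cst_in_polys] by (simp add: cst_def)
  next
    case (Suc d)
    then obtain i where i: "i \<in> Poly_Mapping.keys m"
      by (metis ex_in_conv keys_eq_empty mon_deg_0 nat.distinct(1))
    define m' where "m' = m - Poly_Mapping.single i 1"
    have m: "m = Poly_Mapping.single i 1 + m'"
      using i by (intro poly_mapping_eqI)
        (auto simp: m'_def lookup_add lookup_minus lookup_single when_def in_keys_iff)
    have "Poly_Mapping.single m' c \<in> D"
      using Suc.hyps(2) Suc.prems m by (intro Suc.hyps(1)) (auto simp: mon_deg_add keys_add_nat)
    then have "var i * Poly_Mapping.single m' c \<in> D" using i Suc.prems by (intro D_var) auto
    then show ?case unfolding m by (simp add: var_def mult_single)
  qed
  then have terms: "Poly_Mapping.single m (Poly_Mapping.lookup p m) \<in> D" if "m \<in> Poly_Mapping.keys p" for m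
    using assms that by (auto simp: polys_def)
  have D_sum: "sum f M \<in> D" if "\<And>m. m \<in> M \<Longrightarrow> f m \<in> D" for f and M :: "(nat \<Rightarrow>\<^sub>0 nat) set"
    using that by (induction M rule: infinite_finite_induct) (auto intro: D_add D_V)
  have "(\<Sum>m\<in>Poly_Mapping.keys p. Poly_Mapping.single m (Poly_Mapping.lookup p m)) \<in> D"
    by (intro D_sum terms)
  then have "p \<in> D" by (rule ssubst[OF poly_mapping_expand])
  then show ?thesis by (simp add: D_def)
qed

text \<open>The reduction modulo \<open>v\<close> that keeps the polynomials without the variable \<open>k\<close>; it identifies
  \<open>K[S]/(v)\<close> with \<open>K[V]\<close>.\<close>
definition rho :: "'k mpol \<Rightarrow> 'k mpol" where
  "rho p = (THE p0. p0 \<in> polys V \<and> (\<exists>u\<in>polys S. p = p0 + v * u))"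

lemma rho_eqI:
  assumes "p0 \<in> polys V" "u \<in> polys S" "p = p0 + v * u"
  shows "rho p = p0"
  unfolding rho_def
proof (rule the_equality)
  show "p0 \<in> polys V \<and> (\<exists>u\<in>polys S. p = p0 + v * u)" using assms by blast
  fix p1 assume "p1 \<in> polys V \<and> (\<exists>u\<in>polys S. p = p1 + v * u)"
  then obtain u1 where u1: "p1 \<in> polys V" "p = p1 + v * u1" by blast
  then have eq: "v * (u - u1) = p1 - p0" using assms(3) by (simp add: algebra_simps)
  then have "u - u1 = 0" using u1 assms by (intro multiple_without_var_eq_0) (simp add: polys_diff)
  with eq show "p1 = p0" by simp
qed

lemma rhoE:
  assumes "p \<in> polys S"
  obtains u where "u \<in> polys S" "p = rho p + v * u" "rho p \<in> polys V"
proof -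
  obtain p0 u where "p0 \<in> polys V" "u \<in> polys S" "p = p0 + v * u"
    using decomposition[OF assms] by blast
  moreover from this have rho: "rho p = p0" by (rule rho_eqI)
  ultimately show thesis by (intro that[of u]) (simp_all only: rho)
qed

lemma rho_in_polys:
  assumes "p \<in> polys S"
  shows "rho p \<in> polys V"
  using rhoE[OF assms] .

lemma rho_id: "p \<in> polys V \<Longrightarrow> rho p = p"
  by (rule rho_eqI[of p 0]) simp_all

lemma rho_v_mult: "u \<in> polys S \<Longrightarrow> rho (v * u) = 0"
  by (rule rho_eqI[of 0 u]) simp_all

lemma rho_add:
  assumes "p \<in> polys S" "q \<in> polys S"
  shows "rho (p + q) = rho p + rho q"
proof -
  obtain u w where "u \<in> polys S" "p = rho p + v * u" "w \<in> polys S" "q = rho q + v * w"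
    using assms by (meson rhoE)
  then show ?thesis
    using assms by (intro rho_eqI[of _ "u + w"]) (auto simp: polys_add rho_in_polys algebra_simps)
qed

lemma rho_mult:
  assumes "p \<in> polys S" "q \<in> polys S"
  shows "rho (p * q) = rho p * rho q"
proof -
  obtain u w where u: "u \<in> polys S" "p = rho p + v * u" and w: "w \<in> polys S" "q = rho q + v * w"
    using assms by (meson rhoE)
  have "p * q = rho p * rho q + v * (u * q + rho p * w)"
    by (subst (2) w(2), subst u(2), subst w(2)) (simp add: algebra_simps)
  moreover have "u * q + rho p * w \<in> polys S"
    by (intro polys_add polys_mult u w assms polys_V_S[OF rho_in_polys[OF assms(1)]])
  ultimately show ?thesis
    using assms by (intro rho_eqI) (auto intro: polys_mult rho_in_polys)
qed

lemma rho_sum: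
  "(\<And>i. i \<in> I \<Longrightarrow> f i \<in> polys S) \<Longrightarrow> rho (sum f I) = (\<Sum>i\<in>I. rho (f i))"
proof (induction I rule: infinite_finite_induct)
  case (insert i I)
  then show ?case by (simp add: rho_add polys_sum)
qed (simp_all add: rho_id)

lemma rho_combination:
  assumes "\<And>i. i \<in> I \<Longrightarrow> a i \<in> polys V" "\<And>i. i \<in> I \<Longrightarrow> q i \<in> polys S"
  shows "rho (\<Sum>i\<in>I. a i * q i) = (\<Sum>i\<in>I. a i * rho (q i))"
proof -
  have "rho (\<Sum>i\<in>I. a i * q i) = (\<Sum>i\<in>I. rho (a i * q i))"
    by (intro rho_sum polys_mult polys_V_S[OF assms(1)] assms(2))
  also have "\<dots> = (\<Sum>i\<in>I. a i * rho (q i))"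
    using assms by (intro sum.cong refl) (simp add: rho_mult rho_id polys_V_S)
  finally show ?thesis .
qed

text \<open>As \<open>v\<close> is homogeneous, the degree \<open>d\<close> part of
  \<open>p = rho p + v * u\<close> is another decomposition of \<open>p\<close>, and decompositions
  are unique.\<close>

lemma rho_in_forms:
  assumes "p \<in> forms S d"
  shows "rho p \<in> forms V d"
proof -
  have p: "p \<in> polys S" using assms forms_subset_polys by blast
  obtain u where u: "u \<in> polys S" "p = rho p + v * u" "rho p \<in> polys V" using rhoE[OF p] .
  define u' where "u' = (if 1 \<le> d then component (d - 1) u else 0)"
  have "p = component d (rho p + v * u)"
    using component_form[OF assms, of d] u(2) by simp
  also have "\<dots> = component d (rho p) + v * u'"
    unfolding component_add using component_mult[OF v_form, of d u] by (simp add: u'_def mult.commute)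
  finally have "rho p = component d (rho p)"
    using u component_in_forms forms_subset_polys unfolding u'_def
    by (intro rho_eqI[of _ "if 1 \<le> d then component (d - 1) u else 0"]) (auto; blast)+
  then show ?thesis using component_in_forms[OF u(3)] by metis
qed

lemma mem_gen_plus_iff:
  assumes q: "\<And>i. i \<in> I \<Longrightarrow> q i \<in> polys S" and f: "f \<in> polys S"
  shows "(\<exists>h\<in>polys S. \<exists>g\<in>gen S I q. f = v * h + g) \<longleftrightarrow> rho f \<in> gen V I (\<lambda>i. rho (q i))"
proof
  assume "\<exists>h\<in>polys S. \<exists>g\<in>gen S I q. f = v * h + g"
  then obtain h g where h: "h \<in> polys S" "g \<in> gen S I q" "f = v * h + g" by blast
  obtain a where a: "\<And>i. i \<in> I \<Longrightarrow> a i \<in> polys S" "g = (\<Sum>i\<in>I. a i * q i)"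
    using genE[OF h(2)] by blast
  have "g \<in> polys S" unfolding a(2) by (intro polys_sum polys_mult a q)
  then have "rho f = rho g"
    unfolding h(3) using h(1) v_polys by (simp add: rho_add rho_v_mult polys_mult)
  also have "\<dots> = (\<Sum>i\<in>I. rho (a i) * rho (q i))"
    unfolding a(2) using a(1) q by (simp add: rho_sum rho_mult polys_mult)
  finally show "rho f \<in> gen V I (\<lambda>i. rho (q i))"
    using genI[of I "\<lambda>i. rho (a i)" V "\<lambda>i. rho (q i)"] a(1) rho_in_polys by simp
next
  assume "rho f \<in> gen V I (\<lambda>i. rho (q i))"
  then obtain a where a: "\<And>i. i \<in> I \<Longrightarrow> a i \<in> polys V" "rho f = (\<Sum>i\<in>I. a i * rho (q i))"
    using genE by blast
  let ?g = "\<Sum>i\<in>I. a i * q i"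
  have g: "?g \<in> gen S I q" using a(1) polys_V_S by (intro genI) blast
  have "?g \<in> polys S" using a(1) polys_V_S q by (intro polys_sum polys_mult) blast+
  then obtain w where w: "w \<in> polys S" "?g = rho ?g + v * w" using rhoE by blast
  obtain u where u: "u \<in> polys S" "f = rho f + v * u" using rhoE[OF f] .
  have "rho ?g = rho f"
    unfolding a(2) using a(1) q by (rule rho_combination)
  then have "f - ?g = v * u - v * w"
    using u(2) w(2) by (metis add_diff_cancel_left)
  then have "f = v * (u - w) + ?g" by (simp add: right_diff_distrib diff_eq_eq)
  moreover have "u - w \<in> polys S" using u w by (simp add: polys_diff)
  ultimately have "\<exists>h\<in>polys S. f = v * h + ?g" by blast
  with g show "\<exists>h\<in>polys S. \<exists>g\<in>gen S I q. f = v * h + g" by blast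
qed

text \<open>A syzygy \<open>a\<close> of the reduced quadrics makes the sum of the
  \<open>a i * q i\<close> a multiple v u. By \<open>reg\<close>, u lies in the ideal, with
  coefficients \<open>e\<close>, so \<open>a - v e\<close> is a syzygy of the original quadrics. It
  has the same reduction \<open>a\<close> and inherits the conclusion.\<close>

lemma quadrics_rho:
  assumes Q: "quadrics S I q"
    and reg: "\<And>f. f \<in> polys S \<Longrightarrow> v * f \<in> gen S I q \<Longrightarrow> f \<in> gen S I q"
  shows "quadrics V I (\<lambda>i. rho (q i))"
proof -
  interpret quadrics S I q by (rule Q)
  have q_polys: "q i \<in> polys S" if "i \<in> I" for i using that q_in_forms forms_subset_polys by blast
  have lift: "\<exists>e. (\<forall>i\<in>I. e i \<in> forms S (d - 1)) \<and> (d < 1 \<longrightarrow> (\<forall>i\<in>I. e i = 0))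
      \<and> (\<Sum>i\<in>I. (a i - v * e i) * q i) = 0"
    if a: "\<And>i. i \<in> I \<Longrightarrow> a i \<in> forms V d" and zero: "(\<Sum>i\<in>I. a i * rho (q i)) = 0" and d: "1 \<le> d" for a d
  proof -
    let ?f = "\<Sum>i\<in>I. a i * q i"
    have a': "a i \<in> polys V" "a i \<in> forms S d" if "i \<in> I" for i
      using a[OF that] forms_subset_polys forms_mono[OF V_subset] by blast+
    have f: "?f \<in> forms S (d + 2)" using a' q_in_forms by (intro forms_sum forms_mult)
    then have f_polys: "?f \<in> polys S" using forms_subset_polys by blast
    have "rho ?f = 0"
      using zero rho_combination[of I a q] a'(1) q_polys by simp
    with rhoE[OF f_polys] obtain u where u: "u \<in> polys S" "?f = v * u"
      by (metis add_0)
    have "?f \<in> gen S I q" using a'(1) polys_V_S by (intro genI) blast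
    then have u_gen: "u \<in> gen S I q" using u reg by simp
    obtain e where e: "\<And>i. i \<in> I \<Longrightarrow> e i \<in> forms S (d + 1 - 2)" "component (d + 1) u = (\<Sum>i\<in>I. e i * q i)"
      using component_in_gen[OF q_in_forms u_gen, of "d + 1"] by blast
    have "?f = component (d + 2) (u * v)"
      using component_form[OF f, of "d + 2"] u(2) by (simp add: mult.commute)
    also have "\<dots> = component (d + 1) u * v"
      using component_mult[OF v_form, of "d + 2" u] by simp
    also have "\<dots> = (\<Sum>i\<in>I. v * e i * q i)"
      unfolding e(2) by (simp add: sum_distrib_left sum_distrib_right algebra_simps)
    finally have "(\<Sum>i\<in>I. (a i - v * e i) * q i) = 0"
      by (simp add: left_diff_distrib sum_subtractf)
    moreover have "e i \<in> forms S (d - 1)" if "i \<in> I" for i using e(1)[OF that] by simp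
    ultimately show ?thesis using d by (intro exI[of _ e]) auto
  qed
  have diff: "a i - v * e i \<in> forms S d" "rho (a i - v * e i) = a i"
    if "a i \<in> forms V d" "e i \<in> forms S (d - 1)" "1 \<le> d" for a e i d
  proof -
    have "v * e i \<in> forms S (1 + (d - 1))" by (intro forms_mult v_form that)
    then show "a i - v * e i \<in> forms S d"
      using that forms_mono[OF V_subset, of d] by (auto intro: forms_diff)
    show "rho (a i - v * e i) = a i"
      using that forms_subset_polys
      by (intro rho_eqI[of _ "- e i"]) (auto intro!: polys_uminus)
  qed
  show ?thesis
  proof
    show "finite V" using finite_S by (simp add: V_eq)
    show "finite I" by (rule finite_I)
    show "rho (q i) \<in> forms V 2" if "i \<in> I" for i using that by (intro rho_in_forms q_in_forms)
    fix a :: "nat \<Rightarrow> 'k mpol" and i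
    show "a i = 0" if a: "\<And>i. i \<in> I \<Longrightarrow> a i \<in> forms V 1" "(\<Sum>i\<in>I. a i * rho (q i)) = 0" "i \<in> I"
    proof -
      obtain e where e: "\<forall>i\<in>I. e i \<in> forms S (1 - 1)" "(\<Sum>i\<in>I. (a i - v * e i) * q i) = 0"
        using lift[OF a(1,2)] by auto
      have "a i - v * e i = 0"
        by (rule linear_syzygy[OF _ e(2) a(3)]) (use diff(1)[of a _ 1 e] a(1) e(1) in auto)
      moreover have "rho (a i - v * e i) = a i"
        by (rule diff(2)) (use a(1,3) e(1) in auto)
      ultimately show "a i = 0" by (simp only: rho_id[OF polys_0])
    qed
    assume a: "\<And>i. i \<in> I \<Longrightarrow> a i \<in> forms V 2" "(\<Sum>i\<in>I. a i * rho (q i)) = 0" "i \<in> I"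
    obtain e where e: "\<forall>i\<in>I. e i \<in> forms S (2 - 1)" "(\<Sum>i\<in>I. (a i - v * e i) * q i) = 0"
      using lift[OF a(1,2)] by auto
    have "\<exists>c. a i - v * e i = (\<Sum>j\<in>I. cst (c j) * q j)"
      by (rule quadratic_syzygy[OF _ e(2) a(3)]) (use diff(1)[of a _ 2 e] a(1) e(1) in auto)
    then obtain c where c: "a i - v * e i = (\<Sum>j\<in>I. cst (c j) * q j)" by blast
    have "a i = rho (\<Sum>j\<in>I. cst (c j) * q j)"
      unfolding c[symmetric] by (rule diff(2)[symmetric]) (use a(1,3) e(1) in auto)
    also have "\<dots> = (\<Sum>j\<in>I. cst (c j) * rho (q j))"
      by (intro rho_combination cst_in_polys q_polys)
    finally show "\<exists>c. a i = (\<Sum>j\<in>I. cst (c j) * rho (q j))" by blast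
  qed
qed

end

lemma nonzero_linear_form_elimination:
  assumes "finite S" "v \<in> forms S 1" "v \<noteq> 0"
  obtains k where "elimination S (S - {k}) k v"
proof -
  have "\<exists>k\<in>S. Poly_Mapping.lookup v (Poly_Mapping.single k 1) \<noteq> 0"
  proof (rule ccontr)
    assume "\<not> ?thesis"
    then have "(\<Sum>i\<in>S. cst (Poly_Mapping.lookup v (Poly_Mapping.single i 1)) * var i) = 0"
      by (intro sum.neutral) auto
    with form_1_expand[OF assms(1,2)] assms(3) show False by simp
  qed
  with assms that show thesis by (auto simp: elimination_def)
qed

section \<open>Lifting the weak Lefschetz property\<close>

theorem mainTheorem14:
  fixes n :: nat and qs :: "'k::field_char_0 mpol list" and z w :: "'k mpol"
  assumes "alg_closed_field TYPE('k)"
    and "n + 1 \<ge> 6"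
    and "length qs = n + 1"
    and "\<forall>q\<in>set qs. homog n 2 q"
    and "regular_seq n qs"
    and "homog n 1 z" and "z \<notin> ideal_gen n qs"
    and "homog n 1 w" and "w \<notin> ideal_gen n qs" and "z * w \<in> ideal_gen n qs"
    and "WLP n (ideal_gen n (qs @ [z])) 2"
  shows "WLP n (ideal_gen n qs) 2"
proof -
  define S where "S = {..n}"
  define I where "I = {..<n + 1}"
  define q where "q i = qs ! i" for i
  have fin: "finite S" "finite I" and S_ne: "S \<noteq> {}" by (auto simp: S_def I_def)
  have ideal: "ideal_gen n qs = gen S I q"
    by (simp add: ideal_gen_eq_gen S_def I_def q_def[abs_def] assms(3))
  have q: "q i \<in> forms S 2" if "i \<in> I" for i
    using that assms(3,4) by (auto simp: I_def q_def S_def homog_iff_forms)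
  have q_polys: "q i \<in> polys S" if "i \<in> I" for i
    using q[OF that] forms_subset_polys by blast
  have z: "z \<in> forms S 1" "z \<in> polys S" "z \<noteq> 0" and w: "w \<in> forms S 1" "w \<in> polys S" "w \<noteq> 0"
    using assms(6-9) forms_subset_polys gen_0[of S I q] unfolding ideal homog_iff_forms S_def[symmetric] by auto
  have kos: "koszul_syzygies S I q"
    using regular_seq_koszul_syzygies[OF assms(5), of "n + 1"] q_polys assms(3)
    by (simp add: S_def I_def q_def[abs_def])
  interpret full: quadrics S I q
    by (rule quadrics_of_koszul_syzygies[OF kos fin q S_ne order.refl])
  have zw: "z * w \<in> gen S I q" using assms(10) ideal by simp
  have "z * w \<in> forms S 2" using forms_mult[OF z(1) w(1)] by (simp add: numeral_2_eq_2)
  then obtain c where c: "z * w = (\<Sum>i\<in>I. cst (c i) * q i)"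
    using full.qspan_iff_gen zw by (auto simp: full.qspan_def)
  have "\<exists>j\<in>I. c j \<noteq> 0"
  proof (rule ccontr)
    assume "\<not> ?thesis"
    then have "z * w = 0" unfolding c by (intro sum.neutral) auto
    with z w show False by simp
  qed
  \<comment> \<open>The position \<open>j\<close> cannot be prescribed, which is why every generator
    has to be regular modulo the others.\<close>
  then obtain j where j: "j \<in> I" "c j \<noteq> 0" by blast
  define I' where "I' = I - {j}"
  have I': "I' \<subseteq> I" "finite I'" using fin by (auto simp: I'_def)
  have Q_gen: "gen S I' q \<subseteq> gen S I q" by (rule gen_mono[OF fin(2) I'(1)])
  define r where "r = (\<Sum>i\<in>I'. cst (c i) * q i)"
  have r: "r \<in> gen S I' q" unfolding r_def by (intro genI) simp
  have zw_eq: "z * w = cst (c j) * q j + r"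
    unfolding c r_def I'_def by (rule sum.remove[OF fin(2) j(1)])
  interpret Q: quadrics S I' q
    by (rule quadrics_of_koszul_syzygies[OF kos fin q S_ne I'(1)])
  have inv_mult: "cst (inverse b) * (cst b * p) = p" if "b \<noteq> 0" for b and p :: "'k mpol"
    using that by (simp add: mult.assoc[symmetric] cst_mult[symmetric])
  have q_j: "q j = cst (inverse (c j)) * (z * w - r)"
    unfolding zw_eq using inv_mult[OF j(2)] by simp
  \<comment> \<open>Modulo the other quadrics, \<open>z * w\<close> is a nonzero constant times
    \<open>q j\<close>. Its factors \<open>z\<close> and \<open>w\<close> are then non-zero-divisors
    as well.\<close>
  have zw_regular: "f \<in> gen S I' q" if f: "f \<in> polys S" "f * (z * w) \<in> gen S I' q" for f
  proof -
    have "f * q j = cst (inverse (c j)) * (f * (z * w) - f * r)"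
      unfolding q_j by (simp add: algebra_simps)
    moreover have "\<dots> \<in> gen S I' q"
      by (intro gen_mult[OF cst_in_polys] gen_diff f gen_mult r)
    ultimately show ?thesis
      using generator_regular_mod_others[OF kos fin(2) j(1) f(1)] by (simp add: I'_def)
  qed
  have z_regular: "f \<in> gen S I' q" if "f \<in> polys S" "z * f \<in> gen S I' q" for f
    using zw_regular[OF that(1)] gen_mult[OF w(2) that(2)] by (simp add: algebra_simps)
  have w_regular: "f \<in> gen S I' q" if "f \<in> polys S" "w * f \<in> gen S I' q" for f
    using zw_regular[OF that(1)] gen_mult[OF z(2) that(2)] by (simp add: algebra_simps)
  have q_polys': "q i \<in> polys S" if "i \<in> I'" for i using that I' q_polys by blast
  have gen_I: "\<exists>h\<in>polys S. \<exists>g\<in>gen S I' q. f = z * w * h + g" if f: "f \<in> gen S I q" for f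
  proof -
    obtain a where a: "\<And>i. i \<in> I \<Longrightarrow> a i \<in> polys S" "f = (\<Sum>i\<in>I. a i * q i)"
      using genE[OF f] by blast
    let ?h = "cst (inverse (c j)) * a j" and ?g = "\<Sum>i\<in>I'. a i * q i"
    have "f = a j * q j + ?g" unfolding a(2) I'_def by (rule sum.remove[OF fin(2) j(1)])
    also have "a j * q j = z * w * ?h - ?h * r"
      unfolding q_j by (simp add: algebra_simps)
    finally have "f = z * w * ?h + (?g - ?h * r)" by simp
    moreover have h: "?h \<in> polys S" by (intro polys_mult cst_in_polys a j)
    moreover have "?g - ?h * r \<in> gen S I' q"
      using a(1) I' by (intro gen_diff gen_mult h r genI) blast
    ultimately show ?thesis by blast
  qed
  \<comment> \<open>This also equals I + (z), because \<open>q j\<close> is a multiple of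
    \<open>z\<close> modulo the other quadrics.\<close>
  define Jz where "Jz = {f. \<exists>h\<in>polys S. \<exists>g\<in>gen S I' q. f = z * h + g}"
  have Jz_mult: "a * f \<in> Jz" if a: "a \<in> polys S" and "f \<in> Jz" for a f
  proof -
    obtain h g where "h \<in> polys S" "g \<in> gen S I' q" "f = z * h + g"
      using \<open>f \<in> Jz\<close> unfolding Jz_def by blast
    then have "a * f = z * (a * h) + a * g" "a * h \<in> polys S" "a * g \<in> gen S I' q"
      using a by (simp_all add: algebra_simps polys_mult gen_mult)
    then show ?thesis unfolding Jz_def by blast
  qed
  have Jz_add: "f + f' \<in> Jz" if "f \<in> Jz" "f' \<in> Jz" for f f'
  proof -
    obtain h g h' g' where "h \<in> polys S" "g \<in> gen S I' q" "f = z * h + g"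
      "h' \<in> polys S" "g' \<in> gen S I' q" "f' = z * h' + g'"
      using \<open>f \<in> Jz\<close> \<open>f' \<in> Jz\<close> unfolding Jz_def by blast
    then have "f + f' = z * (h + h') + (g + g')" "h + h' \<in> polys S" "g + g' \<in> gen S I' q"
      by (simp_all add: algebra_simps polys_add gen_add)
    then show ?thesis unfolding Jz_def by blast
  qed
  have z_Jz: "z * h \<in> Jz" if "h \<in> polys S" for h
    unfolding Jz_def using that gen_0[of S I' q] by (intro CollectI bexI[of _ h] bexI[of _ 0]) auto
  have Jz_sub: "mpol.subspace Jz"
    by (intro mpol.subspaceI Jz_add Jz_mult cst_in_polys) (use z_Jz[OF polys_0] in simp_all)
  have I_Jz: "gen S I q \<subseteq> Jz"
  proof
    fix f assume "f \<in> gen S I q"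
    then obtain h g where "h \<in> polys S" "g \<in> gen S I' q" "f = z * w * h + g" using gen_I by blast
    then show "f \<in> Jz" unfolding Jz_def using polys_mult[OF w(2)]
      by (intro CollectI bexI[of _ "w * h"] bexI[of _ g]) (auto simp: algebra_simps)
  qed
  have Jz_ideal: "ideal_gen n (qs @ [z]) = Jz"
  proof (intro equalityI subsetI)
    fix f assume "f \<in> ideal_gen n (qs @ [z])"
    then obtain a where a: "\<And>i. i < n + 2 \<Longrightarrow> a i \<in> polys S"
      "f = (\<Sum>i<Suc (n + 1). a i * (qs @ [z]) ! i)"
      using assms(3) by (auto simp: ideal_gen_def in_S_iff_polys S_def)
    have "f = (\<Sum>i\<in>I. a i * q i) + z * a (n + 1)"
      unfolding a(2) sum.lessThan_Suc I_def q_def using assms(3)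
      by (auto simp: nth_append mult.commute intro!: sum.cong)
    moreover have "(\<Sum>i\<in>I. a i * q i) \<in> Jz"
      using a(1) by (intro subsetD[OF I_Jz] genI) (simp add: I_def)
    ultimately show "f \<in> Jz" using z_Jz[of "a (n + 1)"] a(1) by (simp add: Jz_add)
  next
    fix f assume "f \<in> Jz"
    then obtain h g where h: "h \<in> polys S" "g \<in> gen S I' q" "f = z * h + g"
      unfolding Jz_def by blast
    then obtain a where a: "\<And>i. i \<in> I \<Longrightarrow> a i \<in> polys S" "g = (\<Sum>i\<in>I. a i * q i)"
      using genE subsetD[OF Q_gen] by blast
    let ?a = "\<lambda>i. if i < n + 1 then a i else h"
    have "f = (\<Sum>i<Suc (n + 1). ?a i * (qs @ [z]) ! i)"
      unfolding h(3) a(2) sum.lessThan_Suc I_def q_def using assms(3)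
      by (auto simp: nth_append mult.commute intro!: sum.cong)
    moreover have "\<forall>i<n + 2. in_S n (?a i)"
      using a(1) h(1) by (simp add: in_S_iff_polys S_def I_def)
    ultimately show "f \<in> ideal_gen n (qs @ [z])"
      using assms(3) by (auto simp: ideal_gen_def intro!: exI[of _ ?a])
  qed
  obtain k where "elimination S (S - {k}) k w"
    using nonzero_linear_form_elimination[OF fin(1) w(1,3)] .
  then interpret W: elimination S "S - {k}" k w .
  obtain l where "elimination S (S - {l}) l z"
    using nonzero_linear_form_elimination[OF fin(1) z(1,3)] .
  then interpret Z: elimination S "S - {l}" l z .
  have card_W: "card (S - {k}) = n" and card_Z: "card (S - {l}) = n" and card_I': "card I' = n"
    using W.k_in_S Z.k_in_S j(1) by (auto simp: S_def I_def I'_def)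
  interpret WQ: quadrics "S - {k}" I' "\<lambda>i. W.rho (q i)"
    by (rule W.quadrics_rho[OF Q.quadrics_axioms w_regular])
  interpret ZQ: quadrics "S - {l}" I' "\<lambda>i. Z.rho (q i)"
    by (rule Z.quadrics_rho[OF Q.quadrics_axioms z_regular])
  have Jz_iff: "f \<in> Jz \<longleftrightarrow> Z.rho f \<in> gen (S - {l}) I' (\<lambda>i. Z.rho (q i))" if "f \<in> polys S" for f
    unfolding Jz_def mem_Collect_eq by (rule Z.mem_gen_plus_iff[OF q_polys' that])

  \<comment> \<open>Eliminating \<open>w\<close> gives R/(0 : z), whose degree 1 part is z R^1.
    Since \<open>x1\<close> does not involve \<open>var k\<close>, \<open>W.rho\<close> fixes
    it.\<close>
  obtain x1 where x1: "x1 \<in> forms (S - {k}) 1"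
    "\<And>y. y \<in> forms (S - {k}) 1 \<Longrightarrow> x1 * y \<in> WQ.qspan \<Longrightarrow> y = 0"
    using WQ.exists_injective_linear_form assms(2) card_W infinite_UNIV_char_0 by auto
  have x1_S: "x1 \<in> forms S 1" "x1 \<in> polys S" "x1 \<in> polys (S - {k})"
    using x1(1) forms_mono[of "S - {k}" S] forms_subset_polys by blast+
  have x1_inj: "z * a \<in> gen S I q" if a: "a \<in> forms S 1" "x1 * (z * a) \<in> gen S I q" for a
  proof -
    have a_polys: "a \<in> polys S" using a(1) forms_subset_polys by blast
    obtain h g where h: "h \<in> polys S" "g \<in> gen S I' q" "x1 * (z * a) = z * w * h + g"
      using gen_I[OF a(2)] by blast
    \<comment> \<open>Cancelling \<open>z\<close> modulo the other quadrics moves the relation from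
      the ideal to (w) + Q. Injectivity of \<open>x1\<close> there makes \<open>a\<close> a multiple
      of \<open>w\<close>, and then \<open>z * a\<close> a multiple of \<open>z * w\<close>.\<close>
    then have "z * (x1 * a - w * h) = g" by (simp add: algebra_simps)
    then have zg: "z * (x1 * a - w * h) \<in> gen S I' q" using h(2) by (simp only:)
    have "x1 * a - w * h \<in> polys S" by (intro polys_diff polys_mult x1_S(2) a_polys w(2) h(1))
    then have "x1 * a - w * h \<in> gen S I' q" using zg by (rule z_regular)
    then have "\<exists>h\<in>polys S. \<exists>g\<in>gen S I' q. x1 * a = w * h + g"
      by (intro bexI[OF _ h(1)] bexI[of _ "x1 * a - w * h"]) simp_all
    then have "W.rho (x1 * a) \<in> gen (S - {k}) I' (\<lambda>i. W.rho (q i))"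
      using W.mem_gen_plus_iff[of I' q "x1 * a", OF q_polys' polys_mult[OF x1_S(2) a_polys]] by blast
    then have mem: "x1 * W.rho a \<in> gen (S - {k}) I' (\<lambda>i. W.rho (q i))"
      using x1_S a_polys by (simp add: W.rho_mult W.rho_id)
    have rho_a: "W.rho a \<in> forms (S - {k}) 1" using W.rho_in_forms[OF a(1)] .
    then have "x1 * W.rho a \<in> forms (S - {k}) 2"
      using forms_mult[OF x1(1)] by (simp add: numeral_2_eq_2)
    then have rho_0: "W.rho a = 0" using x1(2)[OF rho_a] WQ.qspan_iff_gen mem by blast
    obtain u where u: "u \<in> polys S" "a = W.rho a + w * u" using W.rhoE[OF a_polys] .
    then have "a = w * u" unfolding rho_0 by (simp only: add_0)
    then have "z * a = u * (z * w)" by (simp add: algebra_simps)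
    then show ?thesis using gen_mult[OF u(1) zw] by (simp only:)
  qed

  obtain x2 where x2: "x2 \<in> forms S 1" "max_rank_mult n Jz x2 2"
    using assms(11) unfolding WLP_def Jz_ideal homog_iff_forms S_def by blast
  have x2_S: "x2 \<in> polys S" using x2(1) forms_subset_polys by blast
  have x2_inj: "f \<in> Jz" if f: "f \<in> forms S 2" "x2 * f \<in> Jz" for f
  proof (cases "\<forall>f. homog n 2 f \<and> x2 * f \<in> Jz \<longrightarrow> f \<in> Jz")
    case True
    then show ?thesis using f by (simp add: homog_iff_forms S_def)
  next
    case False
    \<comment> \<open>Maximal rank leaves surjectivity onto degree 3. It is transported by
      \<open>Z.rho\<close> to \<open>n\<close> quadrics in \<open>n\<close> variables, where the
      dimension count applies.\<close>
    then have surj: "\<exists>h. h \<in> forms S 2 \<and> g - x2 * h \<in> Jz" if "g \<in> forms S 3" for g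
      using x2(2) that unfolding max_rank_mult_def homog_iff_forms S_def by auto
    let ?V = "S - {l}" and ?q = "\<lambda>i. Z.rho (q i)"
    have f_polys: "f \<in> polys S" using f(1) forms_subset_polys by blast
    have rho_x2: "Z.rho x2 \<in> forms ?V 1" and rho_f: "Z.rho f \<in> forms ?V 2"
      using Z.rho_in_forms x2(1) f(1) by blast+
    have "Z.rho (x2 * f) \<in> gen ?V I' ?q"
      by (rule iffD1[OF Jz_iff[OF polys_mult[OF x2_S f_polys]] f(2)])
    then have mem: "Z.rho x2 * Z.rho f \<in> gen ?V I' ?q"
      using x2_S f_polys by (simp add: Z.rho_mult)
    have form: "Z.rho x2 * Z.rho f \<in> forms ?V 3"
      using forms_mult[OF rho_x2 rho_f] by (simp add: numeral_3_eq_3 numeral_2_eq_2)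
    obtain b where b: "\<And>i. i \<in> I' \<Longrightarrow> b i \<in> forms ?V (3 - 2)"
      "Z.rho x2 * Z.rho f = (\<Sum>i\<in>I'. b i * ?q i)"
      using form_in_gen[OF ZQ.q_in_forms mem form] by blast
    have "\<exists>h\<in>forms ?V 2. \<exists>a. (\<forall>i\<in>I'. a i \<in> forms ?V 1) \<and> g = Z.rho x2 * h + (\<Sum>i\<in>I'. a i * ?q i)"
      if g: "g \<in> forms ?V 3" for g
    proof -
      have g_S: "g \<in> forms S 3" "g \<in> polys S" "g \<in> polys ?V"
        using g forms_mono[of ?V S] forms_subset_polys by blast+
      obtain h where h: "h \<in> forms S 2" "g - x2 * h \<in> Jz" using surj[OF g_S(1)] by blast
      have h_polys: "h \<in> polys S" using h(1) forms_subset_polys by blast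
      have rho_h: "Z.rho h \<in> forms ?V 2" using Z.rho_in_forms[OF h(1)] .
      have "Z.rho (g - x2 * h) = Z.rho (g - x2 * h + x2 * h) - Z.rho (x2 * h)"
        using Z.rho_add[of "g - x2 * h" "x2 * h"] g_S(2) x2_S h_polys
        by (simp add: polys_diff polys_mult)
      also have "\<dots> = g - Z.rho x2 * Z.rho h"
        using g_S(3) x2_S h_polys by (simp add: Z.rho_id Z.rho_mult)
      finally have mem: "g - Z.rho x2 * Z.rho h \<in> gen ?V I' ?q"
        using h(2) Jz_iff[of "g - x2 * h"] g_S(2) x2_S h_polys by (simp add: polys_diff polys_mult)
      have form: "g - Z.rho x2 * Z.rho h \<in> forms ?V 3"
        using forms_diff[OF g] forms_mult[OF rho_x2 rho_h] by (simp add: numeral_3_eq_3 numeral_2_eq_2)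
      obtain a where "\<And>i. i \<in> I' \<Longrightarrow> a i \<in> forms ?V (3 - 2)"
        "g - Z.rho x2 * Z.rho h = (\<Sum>i\<in>I'. a i * ?q i)"
        using form_in_gen[OF ZQ.q_in_forms mem form] by blast
      then show ?thesis
        using rho_h by (intro bexI[of _ "Z.rho h"] exI[of _ a]) (auto simp: diff_eq_eq add.commute)
    qed
    then have "Z.rho f \<in> ZQ.qspan"
      using ZQ.surjective_imp_injective[OF _ _ rho_x2 _ rho_f, of b] b assms(2) card_Z card_I' by simp
    then show ?thesis
      using ZQ.qspan_iff_gen[OF rho_f] Jz_iff[OF f_polys] by blast
  qed

  interpret pair: vector_space_pair "\<lambda>c p :: 'k mpol. cst c * p" "\<lambda>c p :: 'k mpol. cst c * p"
    by unfold_locales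
  have linear_mult: "Vector_Spaces.linear (\<lambda>c p. cst c * p) (\<lambda>c p. cst c * p) (\<lambda>p. a * p)"
    for a :: "'k mpol"
    by standard (simp_all add: algebra_simps)
  \<comment> \<open>Parameters for which \<open>x1 + t x2\<close> has a kernel on z R^1. The factor
    \<open>z\<close> is absorbed into both maps, and \<open>V0\<close> consists of the
    \<open>a\<close> with \<open>z * a\<close> in the ideal.\<close>
  let ?T1 = "{t. \<exists>a\<in>forms S 1. a \<notin> {a. z * a \<in> gen S I q} \<and> x1 * z * a + cst t * (x2 * z * a) \<in> gen S I q}"
  \<comment> \<open>Here \<open>x2\<close> is the injective member and must lead the pencil. Since
    x2 + t x1 is proportional to x1 + t^-1 x2, the inverses of these parameters are excluded
    below.\<close>
  let ?T2 = "{t. \<exists>f\<in>forms S 2. f \<notin> Jz \<and> x2 * f + cst t * (x1 * f) \<in> Jz}"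
  obtain B1 B2 :: "'k mpol set" where B: "finite B1" "forms S 1 \<subseteq> mpol.span B1"
    "finite B2" "forms S 2 \<subseteq> mpol.span B2"
    using forms_basis[OF fin(1)] by metis
  have "finite ?T1"
  proof (rule pair.finite_degenerate_members_of_pencil[OF linear_mult linear_mult subspace_forms B(1,2)
        _ subspace_gen])
    show "mpol.subspace {a. z * a \<in> gen S I q}"
      by (rule mpol.subspaceI)
        (auto simp: distrib_left mult.left_commute[of z] gen_0 gen_add gen_mult)
    show "x1 * z * a \<in> gen S I q" "x2 * z * a \<in> gen S I q" if "a \<in> {a. z * a \<in> gen S I q}" for a
      using that gen_mult x1_S x2_S by (auto simp: mult.assoc)
    show "a \<in> {a. z * a \<in> gen S I q}" if "a \<in> forms S 1" "x1 * z * a \<in> gen S I q" for a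
      using that x1_inj by (simp add: mult.assoc)
  qed
  moreover have "finite ?T2"
    by (rule pair.finite_degenerate_members_of_pencil[OF linear_mult linear_mult subspace_forms B(3,4)
        Jz_sub Jz_sub]) (use x1_S x2_S Jz_mult x2_inj in auto)
  ultimately have "finite (insert 0 (?T1 \<union> inverse ` ?T2))" by simp
  from ex_new_if_finite[OF infinite_UNIV_char_0 this]
  obtain t where t: "t \<notin> insert 0 (?T1 \<union> inverse ` ?T2)" ..
  then have t0: "t \<noteq> 0" and t1: "t \<notin> ?T1" and "t \<notin> inverse ` ?T2" by blast+
  have t2: "inverse t \<notin> ?T2"
  proof
    assume "inverse t \<in> ?T2"
    then have "inverse (inverse t) \<in> inverse ` ?T2" by (rule imageI)
    with \<open>t \<notin> inverse ` ?T2\<close> show False by simp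
  qed
  define x where "x = x1 + cst t * x2"
  have x: "x \<in> forms S 1" "x \<in> polys S"
    using forms_subset_polys unfolding x_def
    by (blast intro: forms_add forms_cst_mult x1_S x2)+
  have "f \<in> gen S I q" if f: "f \<in> forms S 2" "x * f \<in> gen S I q" for f
  proof -
    have f_polys: "f \<in> polys S" using f(1) forms_subset_polys by blast
    have "cst (inverse t) * (x * f) = cst (inverse t) * (cst t * (x2 * f)) + cst (inverse t) * (x1 * f)"
      unfolding x_def by (simp add: algebra_simps)
    then have "cst (inverse t) * (x * f) = x2 * f + cst (inverse t) * (x1 * f)"
      using inv_mult[OF t0] by simp
    moreover have "cst (inverse t) * (x * f) \<in> Jz"
      using I_Jz gen_mult[OF cst_in_polys f(2)] by blast
    ultimately have "f \<in> Jz" using t2 f(1) by auto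
    then obtain h g where h: "h \<in> polys S" "g \<in> gen S I' q" "f = z * h + g" unfolding Jz_def by blast
    \<comment> \<open>In degree 2 only the linear part of \<open>h\<close> contributes, so
      \<open>f\<close> is \<open>z * a\<close> plus an element of the ideal.\<close>
    define a where "a = component 1 h"
    have a: "a \<in> forms S 1" unfolding a_def by (rule component_in_forms[OF h(1)])
    obtain e where e: "\<And>i. i \<in> I' \<Longrightarrow> e i \<in> forms S (2 - 2)" "component 2 g = (\<Sum>i\<in>I'. e i * q i)"
      using component_in_gen[OF Q.q_in_forms h(2)] by blast
    have "component 2 (h * z) = component (2 - 1) h * z"
      using component_mult[OF z(1), of 2 h] by simp
    moreover have "component 2 f = f" using component_form[OF f(1), of 2] by simp
    ultimately have f_eq: "f = z * a + component 2 g"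
      unfolding h(3) component_add by (simp add: a_def mult.commute)
    have "component 2 g \<in> gen S I' q"
      unfolding e(2) using e(1) forms_subset_polys by (intro genI) blast
    then have g': "component 2 g \<in> gen S I q" using Q_gen by blast
    \<comment> \<open>Modulo the ideal this is \<open>x * f\<close>, so the choice of
      \<open>t\<close> outside \<open>?T1\<close> applies to \<open>a\<close>.\<close>
    have "x1 * z * a + cst t * (x2 * z * a) = x * f - x * component 2 g"
      unfolding x_def by (subst f_eq) (simp add: algebra_simps)
    also have "\<dots> \<in> gen S I q" by (intro gen_diff f(2) gen_mult x(2) g')
    finally have "z * a \<in> gen S I q" using t1 a by blast
    with g' show ?thesis by (subst f_eq) (rule gen_add)
  qed
  then have "max_rank_mult n (gen S I q) x 2"
    unfolding max_rank_mult_def homog_iff_forms S_def by blast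
  then show ?thesis
    using x(1) unfolding WLP_def ideal homog_iff_forms S_def by blast
qed

end
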